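(* Let $\lambda\in\mathbb{K}$, let $(\mathcal{A},R,d)$, with $\mathcal{A}=(A,[-,-])$, be a modified Rota-Baxter LieDer pair of weight $\lambda$, and let $(V,\rho,R_V,d_V)$ be a representation of it. Then $\big(\mathfrak{C}^\star_{\mathrm{mRBLD}^\lambda}(A;V),\mathfrak{D}^\star_{\mathrm{mRBLD}^\lambda}\big)$ is a cochain complex, i.e. $$\mathfrak{D}^{n+1}_{\mathrm{mRBLD}^\lambda}\circ\mathfrak{D}^n_{\mathrm{mRBLD}^\lambda}=0\qquad\text{for all } n\ge1.$$
   Context: $\mathbb{K}$ is a field of characteristic $0$. A modified Rota-Baxter LieDer pair of weight $\lambda$ is a triple $(\mathcal{A},R,d)$ where $\mathcal{A}=(A,[-,-])$ is a Lie algebra, $R:A\to A$ is linear with $[Ra,Rb]=R([Ra,b]+[a,Rb])+\lambda[a,b]$ for all $a,b\in A$, and $d$ is a derivation of $\mathcal{A}$ with $R\circ d=d\circ R$. A representation of it is $(V,\rho,R_V,d_V)$ with $\rho:A\to\mathrm{gl}(V)$ a Lie algebra representation and $R_V,d_V:V\to V$ linear such that for all $a\in A$, $u\in V$: $\rho(Ra)(R_Vu)=R_V(\rho(Ra)u+\rho(a)(R_Vu))+\lambda\rho(a)u$; $d_V(\rho(a)u)=\rho(da)u+\rho(a)(d_Vu)$; $R_V(d_Vu)=d_V(R_Vu)$. For $n\ge0$ put $C^n(A;V)=C^n_{\mathrm{mRBO}^\lambda}(A;V)=\mathrm{Hom}(\wedge^nA,V)$. The Chevalley–Eilenberg coboundary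 $\delta^n_{\mathrm{CE}}:C^n(A;V)\to C^{n+1}(A;V)$ is $$\delta^n_{\mathrm{CE}}(f)(a_1,\dots,a_{n+1})=\sum_{i=1}^{n+1}(-1)^{i+n}\rho(a_i)f(a_1,\dots,\hat a_i,\dots,a_{n+1})+\sum_{1\le i<j\le n+1}(-1)^{i+j+n+1}f([a_i,a_j],a_1,\dots,\hat a_i,\dots,\hat a_j,\dots,a_{n+1}).$$ The map $\delta^n_{\mathrm{mRBO}^\lambda}$ is given by the same formula with $[-,-]$ replaced by $[a,b]_R=[Ra,b]+[a,Rb]$ and $\rho$ replaced by $\rho_R(a)u=\rho(Ra)u-R_V(\rho(a)u)$. The map $\phi^n:C^n(A;V)\to C^n_{\mathrm{mRBO}^\lambda}(A;V)$ is $\phi^0=\mathrm{Id}_V$ and, for $n\ge1$, $$\phi^n(f)(a_1,\dots,a_n)=f(Ra_1,\dots,Ra_n)-\sum_{\substack{1\le i_1<\cdots<i_r\le n\\ r\text{ odd}}}(-\lambda)^{\frac{r-1}{2}}R_V\big(f(Ra_1,\dots,a_{i_1},\dots,a_{i_r},\dots,Ra_n)\big)+\sum_{\substack{1\le i_1<\cdots<i_r\le n\\ r\ge2\text{ even}}}(-\lambda)^{\frac r2}f(Ra_1,\dots,a_{i_1},\dots,a_{i_r},\dots,Ra_n),$$ where in each summand the entries at positions $i_1,\dots,i_r$ are $a_{i_1},\dots,a_{i_r}$ and all other entries are $Ra_k$. For $n\ge1$, $C^n_{\mathrm{mRBLA}^\lambda}(A;V)=C^n(A;V)\oplus C^{n-1}_{\mathrm{mRBO}^\lambda}(A;V)$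 and $\partial^n_{\mathrm{mRBLA}^\lambda}(f,g)=\big(\delta^n_{\mathrm{CE}}(f),-\delta^{n-1}_{\mathrm{mRBO}^\lambda}(g)-\phi^n(f)\big)$. On $\mathrm{Hom}(\wedge^nA,V)$, $n\ge0$, put $\Delta^n(f)(a_1,\dots,a_n)=\sum_{i=1}^nf(a_1,\dots,da_i,\dots,a_n)-d_V(f(a_1,\dots,a_n))$; on $C^n_{\mathrm{mRBLA}^\lambda}(A;V)$, $n\ge1$, put $\Delta^n(f,g)=(\Delta^n(f),\Delta^{n-1}(g))$. Put $\mathfrak{C}^1_{\mathrm{mRBLD}^\lambda}(A;V)=C^1(A;V)$ and, for $n\ge2$, $\mathfrak{C}^n_{\mathrm{mRBLD}^\lambda}(A;V)=C^n_{\mathrm{mRBLA}^\lambda}(A;V)\times C^{n-1}_{\mathrm{mRBLA}^\lambda}(A;V)$. An element $f\in C^1(A;V)$ is regarded as the element $(f,0)\in C^1_{\mathrm{mRBLA}^\lambda}(A;V)$. The differential is $$\mathfrak{D}^1_{\mathrm{mRBLD}^\lambda}(f)=\big(\partial^1_{\mathrm{mRBLA}^\lambda}(f,0),\,-\Delta^1(f,0)\big),$$ and for $n\ge2$ $$\mathfrak{D}^n_{\mathrm{mRBLD}^\lambda}\big((f,g),(h,s)\big)=\Big(\partial^n_{\mathrm{mRBLA}^\lambda}(f,g),\ \partial^{n-1}_{\mathrm{mRBLA}^\lambda}(h,s)+(-1)^n\Delta^n(f,g)\Big).$$ *)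

theory Defs
  imports
    "HOL-Library.Function_Algebras"
    "HOL-Analysis.Product_Vector"
begin

section \<open>Modified Rota-Baxter LieDer pairs and their representations\<close>

text \<open>
  Vector spaces are given by an abelian group type together with a scalar multiplication
  satisfying \<^locale>\<open>vector_space\<close>.
\<close>

locale lie_algebra = vector_space sA
  for sA :: "'k::field \<Rightarrow> 'a::ab_group_add \<Rightarrow> 'a" +
  fixes br :: "'a \<Rightarrow> 'a \<Rightarrow> 'a"
  assumes bracket_linear_right: "\<And>a. Vector_Spaces.linear sA sA (\<lambda>b. br a b)"
    and bracket_linear_left: "\<And>b. Vector_Spaces.linear sA sA (\<lambda>a. br a b)"
    and bracket_alternating: "\<And>a. br a a = 0"
    and jacobi: "\<And>a b c. br a (br b c) + br b (br c a) + br c (br a b) = 0"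

locale mRB_LieDer_pair = lie_algebra sA br
  for sA :: "'k::field \<Rightarrow> 'a::ab_group_add \<Rightarrow> 'a" and br :: "'a \<Rightarrow> 'a \<Rightarrow> 'a" +
  fixes lam :: 'k and R :: "'a \<Rightarrow> 'a" and d :: "'a \<Rightarrow> 'a"
  assumes R_linear: "Vector_Spaces.linear sA sA R"
    and modified_Rota_Baxter: "\<And>a b. br (R a) (R b) = R (br (R a) b + br a (R b)) + sA lam (br a b)"
    and d_linear: "Vector_Spaces.linear sA sA d"
    and d_derivation: "\<And>a b. d (br a b) = br (d a) b + br a (d b)"
    and R_d_commute: "R \<circ> d = d \<circ> R"

locale lie_representation = lie_algebra sA br + V: vector_space sV
  for sA :: "'k::field \<Rightarrow> 'a::ab_group_add \<Rightarrow> 'a" and br :: "'a \<Rightarrow> 'a \<Rightarrow> 'a"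
    and sV :: "'k \<Rightarrow> 'v::ab_group_add \<Rightarrow> 'v" +
  fixes \<rho> :: "'a \<Rightarrow> 'v \<Rightarrow> 'v"
  assumes \<rho>_endo: "\<And>a. Vector_Spaces.linear sV sV (\<rho> a)"
    and \<rho>_linear: "\<And>u. Vector_Spaces.linear sA sV (\<lambda>a. \<rho> a u)"
    and \<rho>_bracket: "\<And>a b u. \<rho> (br a b) u = \<rho> a (\<rho> b u) - \<rho> b (\<rho> a u)"

locale mRB_LieDer_representation =
  mRB_LieDer_pair sA br lam R d + lie_representation sA br sV \<rho>
  for sA :: "'k::field \<Rightarrow> 'a::ab_group_add \<Rightarrow> 'a" and br :: "'a \<Rightarrow> 'a \<Rightarrow> 'a"
    and lam :: 'k and R :: "'a \<Rightarrow> 'a" and d :: "'a \<Rightarrow> 'a"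
    and sV :: "'k \<Rightarrow> 'v::ab_group_add \<Rightarrow> 'v" and \<rho> :: "'a \<Rightarrow> 'v \<Rightarrow> 'v" +
  fixes R\<^sub>V :: "'v \<Rightarrow> 'v" and d\<^sub>V :: "'v \<Rightarrow> 'v"
  assumes RV_linear: "Vector_Spaces.linear sV sV R\<^sub>V"
    and dV_linear: "Vector_Spaces.linear sV sV d\<^sub>V"
    and \<rho>_RV: "\<And>a u. \<rho> (R a) (R\<^sub>V u) = R\<^sub>V (\<rho> (R a) u + \<rho> a (R\<^sub>V u)) + sV lam (\<rho> a u)"
    and \<rho>_dV: "\<And>a u. d\<^sub>V (\<rho> a u) = \<rho> (d a) u + \<rho> a (d\<^sub>V u)"
    and RV_dV: "\<And>u. R\<^sub>V (d\<^sub>V u) = d\<^sub>V (R\<^sub>V u)"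


section \<open>Cochains\<close>

text \<open>
  An element of \<open>Hom(\<Lambda>\<^sup>n A, V)\<close> is an alternating multilinear map in \<open>n\<close> arguments.  The
  arguments are collected in a list of length \<open>n\<close>, and the map is extended by \<open>0\<close> to all other
  lists, so that two cochains are equal iff they agree on all \<open>n\<close>-tuples.  List positions count
  from \<open>0\<close>: the argument \<open>a\<^sub>i\<close> of the usual notation is \<open>as ! (i - 1)\<close>.
\<close>

definition alt_maps ::
  "('k::field \<Rightarrow> 'a::ab_group_add \<Rightarrow> 'a) \<Rightarrow> ('k \<Rightarrow> 'v::ab_group_add \<Rightarrow> 'v)
    \<Rightarrow> nat \<Rightarrow> ('a list \<Rightarrow> 'v) set" where
  "alt_maps sA sV n = {f.
     (\<forall>as i. length as = n \<and> i < n \<longrightarrow> Vector_Spaces.linear sA sV (\<lambda>x. f (as[i := x]))) \<and>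
     (\<forall>as i j. length as = n \<and> i < j \<and> j < n \<and> as ! i = as ! j \<longrightarrow> f as = 0) \<and>
     (\<forall>as. length as \<noteq> n \<longrightarrow> f as = 0)}"

definition on_tuples :: "nat \<Rightarrow> ('a list \<Rightarrow> 'v::zero) \<Rightarrow> 'a list \<Rightarrow> 'v" where
  "on_tuples n F as = (if length as = n then F as else 0)"

text \<open>
  \<^term>\<open>nths as (- {i})\<close> is \<open>as\<close> with position \<open>i\<close> omitted.  Because positions count from \<open>0\<close>,
  the sign \<open>(-1)\<^bsup>i+n\<^esup>\<close> of the usual formula becomes \<open>(-1)\<^bsup>(i+1)+n\<^esup>\<close>, and
  \<open>(-1)\<^bsup>i+j+n+1\<^esup>\<close> becomes \<open>(-1)\<^bsup>(i+1)+(j+1)+n+1\<^esup>\<close>.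
\<close>

definition CE_coboundary ::
  "('k::field \<Rightarrow> 'v::ab_group_add \<Rightarrow> 'v) \<Rightarrow> ('a \<Rightarrow> 'a \<Rightarrow> 'a) \<Rightarrow> ('a \<Rightarrow> 'v \<Rightarrow> 'v)
    \<Rightarrow> nat \<Rightarrow> ('a list \<Rightarrow> 'v) \<Rightarrow> 'a list \<Rightarrow> 'v" where
  "CE_coboundary sV br \<rho> n f = on_tuples (n + 1) (\<lambda>as.
     (\<Sum>i<n+1. sV ((-1) ^ ((i+1) + n)) (\<rho> (as ! i) (f (nths as (- {i}))))) +
     (\<Sum>j<n+1. \<Sum>i<j. sV ((-1) ^ ((i+1) + (j+1) + n + 1))
        (f (br (as ! i) (as ! j) # nths as (- {i, j})))))"

definition mRBO_coboundary ::
  "('k::field \<Rightarrow> 'v::ab_group_add \<Rightarrow> 'v) \<Rightarrow> ('a::ab_group_add \<Rightarrow> 'a \<Rightarrow> 'a) \<Rightarrow> ('a \<Rightarrow> 'a)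
    \<Rightarrow> ('a \<Rightarrow> 'v \<Rightarrow> 'v) \<Rightarrow> ('v \<Rightarrow> 'v) \<Rightarrow> nat \<Rightarrow> ('a list \<Rightarrow> 'v) \<Rightarrow> 'a list \<Rightarrow> 'v" where
  "mRBO_coboundary sV br R \<rho> R\<^sub>V =
     CE_coboundary sV (\<lambda>a b. br (R a) b + br a (R b)) (\<lambda>a u. \<rho> (R a) u - R\<^sub>V (\<rho> a u))"

definition R_except :: "('a \<Rightarrow> 'a) \<Rightarrow> nat set \<Rightarrow> 'a list \<Rightarrow> 'a list" where
  "R_except R I as = map (\<lambda>k. if k \<in> I then as ! k else R (as ! k)) [0..<length as]"

text \<open>The index sets \<open>{i\<^sub>1 < \<dots> < i\<^sub>r}\<close> are the sets \<open>I\<close> of positions, with \<open>r = card I\<close>.\<close>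

definition phi ::
  "('k::field \<Rightarrow> 'v::ab_group_add \<Rightarrow> 'v) \<Rightarrow> 'k \<Rightarrow> ('a \<Rightarrow> 'a) \<Rightarrow> ('v \<Rightarrow> 'v)
    \<Rightarrow> nat \<Rightarrow> ('a list \<Rightarrow> 'v) \<Rightarrow> 'a list \<Rightarrow> 'v" where
  "phi sV lam R R\<^sub>V n f = (if n = 0 then f else on_tuples n (\<lambda>as.
     f (map R as)
     - (\<Sum>I | I \<subseteq> {..<n} \<and> odd (card I).
          sV ((- lam) ^ ((card I - 1) div 2)) (R\<^sub>V (f (R_except R I as))))
     + (\<Sum>I | I \<subseteq> {..<n} \<and> card I \<ge> 2 \<and> even (card I).
          sV ((- lam) ^ (card I div 2)) (f (R_except R I as)))))"

definition Delta ::
  "('a \<Rightarrow> 'a) \<Rightarrow> ('v \<Rightarrow> 'v) \<Rightarrow> nat \<Rightarrow> ('a list \<Rightarrow> 'v::ab_group_add) \<Rightarrow> 'a list \<Rightarrow> 'v" where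
  "Delta d d\<^sub>V n f = on_tuples n (\<lambda>as. (\<Sum>i<n. f (as[i := d (as ! i)])) - d\<^sub>V (f as))"


section \<open>The cochain complexes\<close>

type_synonym ('a, 'v) cochain = "'a list \<Rightarrow> 'v"
type_synonym ('a, 'v) cochain2 = "('a, 'v) cochain \<times> ('a, 'v) cochain"
type_synonym ('a, 'v) cochain4 = "('a, 'v) cochain2 \<times> ('a, 'v) cochain2"

definition fun_scale :: "('k \<Rightarrow> 'v \<Rightarrow> 'v) \<Rightarrow> 'k \<Rightarrow> ('x \<Rightarrow> 'v) \<Rightarrow> 'x \<Rightarrow> 'v" where
  "fun_scale s c f = (\<lambda>x. s c (f x))"

definition scale2 ::
  "('k::field \<Rightarrow> 'v::ab_group_add \<Rightarrow> 'v) \<Rightarrow> 'k \<Rightarrow> ('a, 'v) cochain2 \<Rightarrow> ('a, 'v) cochain2" where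
  "scale2 sV = module_prod.scale (fun_scale sV) (fun_scale sV)"

definition scale4 ::
  "('k::field \<Rightarrow> 'v::ab_group_add \<Rightarrow> 'v) \<Rightarrow> 'k \<Rightarrow> ('a, 'v) cochain4 \<Rightarrow> ('a, 'v) cochain4" where
  "scale4 sV = module_prod.scale (scale2 sV) (scale2 sV)"

text \<open>The spaces and maps with index \<open>mRBLA\<close> are meaningful in degrees \<open>n \<ge> 1\<close> only.\<close>

definition mRBLA_cochains ::
  "('k::field \<Rightarrow> 'a::ab_group_add \<Rightarrow> 'a) \<Rightarrow> ('k \<Rightarrow> 'v::ab_group_add \<Rightarrow> 'v)
    \<Rightarrow> nat \<Rightarrow> ('a, 'v) cochain2 set" where
  "mRBLA_cochains sA sV n = alt_maps sA sV n \<times> alt_maps sA sV (n - 1)"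

definition mRBLA_diff ::
  "('k::field \<Rightarrow> 'v::ab_group_add \<Rightarrow> 'v) \<Rightarrow> ('a::ab_group_add \<Rightarrow> 'a \<Rightarrow> 'a) \<Rightarrow> 'k \<Rightarrow> ('a \<Rightarrow> 'a)
    \<Rightarrow> ('a \<Rightarrow> 'v \<Rightarrow> 'v) \<Rightarrow> ('v \<Rightarrow> 'v) \<Rightarrow> nat \<Rightarrow> ('a, 'v) cochain2 \<Rightarrow> ('a, 'v) cochain2" where
  "mRBLA_diff sV br lam R \<rho> R\<^sub>V n = (\<lambda>(f, g).
     (CE_coboundary sV br \<rho> n f,
      - mRBO_coboundary sV br R \<rho> R\<^sub>V (n - 1) g - phi sV lam R R\<^sub>V n f))"

definition mRBLA_Delta ::
  "('a \<Rightarrow> 'a) \<Rightarrow> ('v \<Rightarrow> 'v) \<Rightarrow> nat \<Rightarrow> ('a, 'v::ab_group_add) cochain2 \<Rightarrow> ('a, 'v) cochain2" where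
  "mRBLA_Delta d d\<^sub>V n = (\<lambda>(f, g). (Delta d d\<^sub>V n f, Delta d d\<^sub>V (n - 1) g))"

text \<open>
  The degree-\<open>1\<close> space of the final complex is \<open>C\<^sup>1(A;V)\<close>, while in degrees \<open>n \<ge> 2\<close> it is a product
  of two \<open>mRBLA\<close> cochain spaces.  To have one type for all degrees, \<open>f \<in> C\<^sup>1(A;V)\<close> is represented
  by \<open>((f, 0), (0, 0))\<close>.  Degree \<open>0\<close> is not part of the complex.
\<close>

definition mRBLD_cochains ::
  "('k::field \<Rightarrow> 'a::ab_group_add \<Rightarrow> 'a) \<Rightarrow> ('k \<Rightarrow> 'v::ab_group_add \<Rightarrow> 'v)
    \<Rightarrow> nat \<Rightarrow> ('a, 'v) cochain4 set" where
  "mRBLD_cochains sA sV n =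
     (if n = 1 then (\<lambda>f. ((f, 0), (0, 0))) ` alt_maps sA sV 1
      else mRBLA_cochains sA sV n \<times> mRBLA_cochains sA sV (n - 1))"

definition mRBLD_diff ::
  "('k::field \<Rightarrow> 'v::ab_group_add \<Rightarrow> 'v) \<Rightarrow> ('a::ab_group_add \<Rightarrow> 'a \<Rightarrow> 'a) \<Rightarrow> 'k
    \<Rightarrow> ('a \<Rightarrow> 'a) \<Rightarrow> ('a \<Rightarrow> 'a) \<Rightarrow> ('a \<Rightarrow> 'v \<Rightarrow> 'v) \<Rightarrow> ('v \<Rightarrow> 'v) \<Rightarrow> ('v \<Rightarrow> 'v)
    \<Rightarrow> nat \<Rightarrow> ('a, 'v) cochain4 \<Rightarrow> ('a, 'v) cochain4" where
  "mRBLD_diff sV br lam R d \<rho> R\<^sub>V d\<^sub>V n = (\<lambda>((f, g), (h, s)).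
     if n = 1 then
       (mRBLA_diff sV br lam R \<rho> R\<^sub>V 1 (f, 0), - mRBLA_Delta d d\<^sub>V 1 (f, 0))
     else
       (mRBLA_diff sV br lam R \<rho> R\<^sub>V n (f, g),
        mRBLA_diff sV br lam R \<rho> R\<^sub>V (n - 1) (h, s)
          + scale2 sV ((-1) ^ n) (mRBLA_Delta d d\<^sub>V n (f, g))))"

text \<open>
  A cochain complex of vector spaces in degrees \<open>n \<ge> m\<close>; all its spaces are subspaces of one
  ambient vector space.
\<close>

locale cochain_complex = vector_space scale
  for scale :: "'k::field \<Rightarrow> 'c::ab_group_add \<Rightarrow> 'c" +
  fixes m :: nat and C :: "nat \<Rightarrow> 'c set" and D :: "nat \<Rightarrow> 'c \<Rightarrow> 'c"
  assumes C_subspace: "\<And>n. n \<ge> m \<Longrightarrow> subspace (C n)"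
    and D_maps: "\<And>n x. n \<ge> m \<Longrightarrow> x \<in> C n \<Longrightarrow> D n x \<in> C (n + 1)"
    and D_add: "\<And>n x y. n \<ge> m \<Longrightarrow> x \<in> C n \<Longrightarrow> y \<in> C n \<Longrightarrow> D n (x + y) = D n x + D n y"
    and D_scale: "\<And>n c x. n \<ge> m \<Longrightarrow> x \<in> C n \<Longrightarrow> D n (scale c x) = scale c (D n x)"
    and D_D: "\<And>n x. n \<ge> m \<Longrightarrow> x \<in> C n \<Longrightarrow> D (n + 1) (D n x) = 0"

end

theory Submission
  imports Defs
begin

text \<open>
  Write \<open>D\<close> for the Chevalley-Eilenberg differential of \<open>(A, \<rho>)\<close>, \<open>DR\<close> for that of the descendent
  Lie algebra \<open>(A, [a,b]\<^sub>R)\<close> with coefficients in \<open>\<rho>\<^sub>R\<close>, and \<open>L\<close> for the action of the derivation pair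
  \<open>(d, d\<^sub>V)\<close> on cochains, so that \<open>\<Delta> = - L\<close>.  Apart from the truncation in low degrees, the total
  complex is a mapping cone of a mapping cone: first of \<open>\<phi>\<close> between the two Chevalley-Eilenberg
  complexes, then of \<open>\<Delta>\<close> on the result.  Its differential squares to zero because \<open>D D = 0\<close>, \<open>DR DR = 0\<close>, \<open>DR \<phi> = \<phi> D\<close>, and \<open>L\<close> commutes with \<open>D\<close>, \<open>DR\<close> and \<open>\<phi>\<close>.

  All these identities come from Cartan's calculus.  Let \<open>i\<^sub>a\<close> be contraction with \<open>a\<close>, which for maps on
  lists is \<open>f \<mapsto> f (a # \<cdot>)\<close>, and let \<open>L\<^sub>a\<close> be the Lie derivative.  Up to signs \<open>i\<^sub>a D = D i\<^sub>a \<plusminus> L\<^sub>a\<close> and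
  \<open>i\<^sub>b L\<^sub>a = L\<^sub>a i\<^sub>b - i\<^bsub>[a,b]\<^esub>\<close>; since a map on nonempty lists is determined by its contractions, these
  formulas serve as recursive definitions, and each identity follows by induction on the argument list
  from \<open>[L\<^sub>a, L\<^sub>b] = L\<^bsub>[a,b]\<^esub>\<close> and \<open>[L\<^sub>a, D] = 0\<close>.  The recursions do not mention the degree, so they are
  applied to alternating forms with components in all degrees; \<open>D_eq_sum\<close>, \<open>phi_eq_twist\<close> and
  \<open>Delta_eq_lie_deriv\<close> identify the recursive operators with the explicit sums.

  The reason why \<open>\<phi>\<close> is a chain map is easiest to see after adjoining \<open>\<mu>\<close> with \<open>\<mu>\<^sup>2 = - \<lambda>\<close>: the modified
  Rota-Baxter equation says that \<open>R + \<mu>\<close> is a homomorphism from the descendent Lie algebra to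
  \<open>A\<close>, and the condition on \<open>R\<^sub>V\<close> says that \<open>\<mu> - R\<^sub>V\<close> intertwines \<open>\<rho> \<circ> (R + \<mu>)\<close> with \<open>\<rho>\<^sub>R\<close>.  Hence
  \<open>f \<mapsto> (\<mu> - R\<^sub>V) (f \<circ> (R + \<mu>))\<close> is a chain map, and \<open>\<phi>\<close> is its \<open>\<mu>\<close>-component.  The operator \<open>twist\<close>
  describes such components without extending the field.
\<close>

section \<open>Alternating forms of all degrees at once\<close>

lemma lin_add: "Vector_Spaces.linear s t F \<Longrightarrow> F (x + y) = F x + F y"
  and lin_scale: "Vector_Spaces.linear s t F \<Longrightarrow> F (s c x) = t c (F x)"
  by (simp_all add: Vector_Spaces.linear_iff)

lemma lin_zero: "Vector_Spaces.linear s t F \<Longrightarrow> F 0 = 0"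
  and lin_neg: "Vector_Spaces.linear s t F \<Longrightarrow> F (- x) = - F x"
  and lin_diff: "Vector_Spaces.linear s t F \<Longrightarrow> F (x - y) = F x - F y"
  by (simp_all add: linear_iff_module_hom module_hom.zero module_hom.neg module_hom.diff)

lemmas lin = lin_add lin_scale lin_zero lin_neg lin_diff

lemma vector_space_fun_scale:
  assumes "vector_space s" shows "vector_space (fun_scale s)"
proof -
  interpret vector_space s by fact
  show ?thesis
    by unfold_locales (auto simp: fun_scale_def fun_eq_iff scale_right_distrib scale_left_distrib)
qed

definition contract :: "'a \<Rightarrow> ('a list \<Rightarrow> 'v) \<Rightarrow> 'a list \<Rightarrow> 'v" where
  "contract a f as = f (a # as)"

text \<open>
  The derivation action \<open>r (f (a\<^sub>1, \<dots>, a\<^sub>n)) - \<Sum>\<^sub>i f (a\<^sub>1, \<dots>, t a\<^sub>i, \<dots>, a\<^sub>n)\<close> in recursive form.  It is the Lie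
  derivative along \<open>a\<close> for \<open>t = [a, \<cdot>]\<close>, \<open>r = \<rho> a\<close>, and it is \<open>- \<Delta>\<close> for \<open>t = d\<close>, \<open>r = d\<^sub>V\<close>.
\<close>

fun lie_deriv ::
  "('a \<Rightarrow> 'a) \<Rightarrow> ('v \<Rightarrow> 'v) \<Rightarrow> ('a list \<Rightarrow> 'v::ab_group_add) \<Rightarrow> 'a list \<Rightarrow> 'v" where
  "lie_deriv t r f [] = r (f [])"
| "lie_deriv t r f (b # bs) = lie_deriv t r (contract b f) bs - f (t b # bs)"

text \<open>
  The component of degree \<open>n\<close> is multiplied by \<open>(-1)\<^bsup>n+1\<^esup>\<close>, which is the sign of the Lie derivative in
  Cartan's formula for the present normalization of the coboundary.
\<close>

definition grading_sign :: "('a list \<Rightarrow> 'v::ab_group_add) \<Rightarrow> 'a list \<Rightarrow> 'v" where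
  "grading_sign f as = (if even (length as) then - f as else f as)"

text \<open>
  Cartan's magic formula, read as a definition of the differential.
\<close>

fun cartan_diff ::
  "('a \<Rightarrow> 'a \<Rightarrow> 'a) \<Rightarrow> ('a \<Rightarrow> 'v \<Rightarrow> 'v) \<Rightarrow> ('a list \<Rightarrow> 'v::ab_group_add) \<Rightarrow> 'a list \<Rightarrow> 'v" where
  "cartan_diff br \<rho> f [] = 0"
| "cartan_diff br \<rho> f (a # as) =
     cartan_diff br \<rho> (contract a f) as + grading_sign (lie_deriv (br a) (\<rho> a) f) as"

text \<open>
  The condition is imposed in all degrees simultaneously.  Vanishing on equal neighbours suffices for
  alternation (see \<open>alt_maps_iff\<close>), and this form of the condition passes to contractions and to the
  recursively defined operators by induction on the list \<open>xs\<close> in front of the argument.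
\<close>

definition alternating_form ::
  "('k::field \<Rightarrow> 'a::ab_group_add \<Rightarrow> 'a) \<Rightarrow> ('k \<Rightarrow> 'v::ab_group_add \<Rightarrow> 'v)
    \<Rightarrow> ('a list \<Rightarrow> 'v) \<Rightarrow> bool" where
  "alternating_form sA sV f \<longleftrightarrow>
     (\<forall>xs ys. Vector_Spaces.linear sA sV (\<lambda>x. f (xs @ x # ys))) \<and>
     (\<forall>xs a ys. f (xs @ a # a # ys) = 0)"

lemma contract_lie_deriv:
  "contract b (lie_deriv t r f) = lie_deriv t r (contract b f) - contract (t b) f"
  by (rule ext) (simp add: contract_def)

lemma contract_cartan_diff:
  "contract a (cartan_diff br \<rho> f) =
     cartan_diff br \<rho> (contract a f) + grading_sign (lie_deriv (br a) (\<rho> a) f)"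
  by (rule ext) (simp add: contract_def)

lemma contract_algebra:
  "contract a (f + g) = contract a f + contract a g"
  "contract a (f - g) = contract a f - contract a g"
  "contract a (- f) = - contract a f"
  "contract a 0 = 0"
  "contract a (fun_scale s c f) = fun_scale s c (contract a f)"
  by (auto simp: contract_def fun_scale_def)

lemma grading_sign_algebra:
  "grading_sign (f + g) = grading_sign f + grading_sign g"
  "grading_sign (f - g) = grading_sign f - grading_sign g"
  "grading_sign (- f) = - grading_sign f"
  "grading_sign 0 = 0"
  by (auto simp: grading_sign_def)

lemma contract_grading_sign: "contract a (grading_sign f) = - grading_sign (contract a f)"
  by (auto simp: grading_sign_def contract_def)

locale coefficient_spaces = A: vector_space sA + V: vector_space sV
  for sA :: "'k::field \<Rightarrow> 'a::ab_group_add \<Rightarrow> 'a"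
    and sV :: "'k \<Rightarrow> 'v::ab_group_add \<Rightarrow> 'v"
begin

abbreviation "alt \<equiv> alternating_form sA sV"
abbreviation "linVV \<equiv> Vector_Spaces.linear sV sV"
abbreviation "linAA \<equiv> Vector_Spaces.linear sA sA"
abbreviation "linAV \<equiv> Vector_Spaces.linear sA sV"
abbreviation "linFF \<equiv> Vector_Spaces.linear (fun_scale sV :: 'k \<Rightarrow> ('a list \<Rightarrow> 'v) \<Rightarrow> _)
  (fun_scale sV :: 'k \<Rightarrow> ('a list \<Rightarrow> 'v) \<Rightarrow> _)"

lemma linAV_I:
  assumes "\<And>x y. F (x + y) = F x + F y" "\<And>c x. F (sA c x) = sV c (F x)"
  shows "linAV F"
  using assms A.vector_space_axioms V.vector_space_axioms by (simp add: Vector_Spaces.linear_iff)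

lemma linFF_I:
  assumes "\<And>f g as. F (f + g) as = F f as + F g as"
    and "\<And>c f as. F (fun_scale sV c f) as = sV c (F f as)"
  shows "linFF F"
  unfolding Vector_Spaces.linear_iff
proof (intro conjI allI)
  show "vector_space (fun_scale sV :: 'k \<Rightarrow> ('a list \<Rightarrow> 'v) \<Rightarrow> _)"
    by (rule vector_space_fun_scale[OF V.vector_space_axioms])
  then show "vector_space (fun_scale sV :: 'k \<Rightarrow> ('a list \<Rightarrow> 'v) \<Rightarrow> _)" .
  show "F (f + g) = F f + F g" for f g using assms(1) by (intro ext) simp
  show "F (fun_scale sV c f) = fun_scale sV c (F f)" for c f
    by (rule ext) (simp only: assms(2) fun_scale_def[of sV c "F f"])
qed

lemma linFF_comp_linear:
  assumes "Vector_Spaces.linear sA (fun_scale sV) G" "linFF F"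
  shows "linAV (\<lambda>x. F (G x) as)"
  by (rule linAV_I) (simp_all add: lin[OF assms(1)] lin[OF assms(2)], simp add: fun_scale_def)

lemma alternating_formI:
  assumes "\<And>xs ys. linAV (\<lambda>x. f (xs @ x # ys))" "\<And>xs a ys. f (xs @ a # a # ys) = 0"
  shows "alt f"
  using assms by (auto simp: alternating_form_def)

lemma alt_adjacent: "alt f \<Longrightarrow> f (xs @ a # a # ys) = 0"
  by (simp add: alternating_form_def)

lemma alt_lin: "alt f \<Longrightarrow> linAV (\<lambda>x. f (xs @ x # ys))"
  by (simp add: alternating_form_def)

lemma alt_lin_hd: "alt f \<Longrightarrow> linAV (\<lambda>x. f (x # ys))"
  using alt_lin[of f "[]"] by simp

lemma alt_contract: "alt f \<Longrightarrow> alt (contract a f)"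
  using alt_lin[of f "a # xs" for xs] alt_adjacent[of f "a # xs" for xs]
  by (intro alternating_formI) (simp_all add: contract_def)

lemma alt_contract_linear: "alt f \<Longrightarrow> Vector_Spaces.linear sA (fun_scale sV) (\<lambda>x. contract x f)"
proof -
  assume "alt f"
  then have *: "linAV (\<lambda>x. f (x # ys))" for ys by (rule alt_lin_hd)
  show ?thesis
    unfolding Vector_Spaces.linear_iff
    using A.vector_space_axioms vector_space_fun_scale[OF V.vector_space_axioms]
      lin_add[OF *] lin_scale[OF *]
    by (auto simp: contract_def fun_eq_iff fun_scale_def)
qed

lemma alt_contract_twice: "alt f \<Longrightarrow> contract a (contract a f) = 0"
  using alt_adjacent[of f "[]"] by (intro ext) (simp add: contract_def)

lemma alt_contract_skew:
  assumes "alt f" shows "contract a (contract b f) = - contract b (contract a f)"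
proof -
  note l = lin_add[OF alt_contract_linear[OF assms]]
  note l' = lin_add[OF alt_contract_linear[OF alt_contract[OF assms]]]
  have "contract (a + b) (contract (a + b) f) = 0" by (rule alt_contract_twice[OF assms])
  then have "contract a (contract b f) + contract b (contract a f) = 0"
    by (simp add: l l' contract_algebra alt_contract_twice[OF assms] add.commute)
  then show ?thesis by (simp add: eq_neg_iff_add_eq_0)
qed

lemma linAV_add: "linAV F \<Longrightarrow> linAV G \<Longrightarrow> linAV (\<lambda>x. F x + G x)"
  by (rule linAV_I) (simp_all add: lin_add lin_scale V.scale_right_distrib algebra_simps)

lemma linAV_diff: "linAV F \<Longrightarrow> linAV G \<Longrightarrow> linAV (\<lambda>x. F x - G x)"
  by (rule linAV_I) (simp_all add: lin_add lin_scale V.scale_right_diff_distrib algebra_simps)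

lemma linAV_neg: "linAV F \<Longrightarrow> linAV (\<lambda>x. - F x)"
  by (rule linAV_I) (simp_all add: lin_add lin_scale)

lemma linAV_scale: "linAV F \<Longrightarrow> linAV (\<lambda>x. sV c (F x))"
  by (rule linAV_I) (simp_all add: lin_add lin_scale V.scale_right_distrib mult.commute)

lemma linAV_zero: "linAV (\<lambda>x. 0)"
  by (rule linAV_I) simp_all

lemma alt_zero: "alt 0"
  by (rule alternating_formI) (simp_all add: linAV_zero)

lemma alt_add: "alt f \<Longrightarrow> alt g \<Longrightarrow> alt (f + g)"
  by (rule alternating_formI) (simp_all add: linAV_add alt_lin alt_adjacent)

lemma alt_scale: "alt f \<Longrightarrow> alt (fun_scale sV c f)"
  by (rule alternating_formI) (simp_all add: fun_scale_def linAV_scale alt_lin alt_adjacent)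

lemma alt_neg: "alt f \<Longrightarrow> alt (- f)"
  by (rule alternating_formI) (simp_all add: linAV_neg alt_lin alt_adjacent)

lemma alt_diff: "alt f \<Longrightarrow> alt g \<Longrightarrow> alt (f - g)"
  by (rule alternating_formI) (simp_all add: linAV_diff alt_lin alt_adjacent)

lemma alt_grading_sign: "alt f \<Longrightarrow> alt (grading_sign f)"
  by (rule alternating_formI, case_tac "even (length (xs @ undefined # ys))")
    (simp_all add: grading_sign_def if_distrib linAV_neg alt_lin alt_adjacent)

lemma linFF_lie_deriv:
  assumes "linVV r" shows "linFF (lie_deriv t r)"
proof (rule linFF_I)
  show "lie_deriv t r (f + g) as = lie_deriv t r f as + lie_deriv t r g as" for f g as
    by (induction as arbitrary: f g) (simp_all add: lin[OF assms] contract_algebra)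
  show "lie_deriv t r (fun_scale sV c f) as = sV c (lie_deriv t r f as)" for c f as
    by (induction as arbitrary: f)
      (simp_all add: lin[OF assms] contract_algebra, simp_all add: fun_scale_def lin[OF assms] V.scale_right_diff_distrib)
qed

lemma grading_sign_scale:
  "grading_sign (fun_scale sV c f) = fun_scale sV c (grading_sign f)"
  by (auto simp: fun_scale_def grading_sign_def)

lemma linFF_cartan_diff:
  assumes "\<And>a. linVV (\<rho> a)" shows "linFF (cartan_diff br \<rho>)"
proof (rule linFF_I)
  note l = lin[OF linFF_lie_deriv[OF assms]]
  show "cartan_diff br \<rho> (f + g) as = cartan_diff br \<rho> f as + cartan_diff br \<rho> g as" for f g as
    by (induction as arbitrary: f g) (simp_all add: l contract_algebra grading_sign_algebra)
  show "cartan_diff br \<rho> (fun_scale sV c f) as = sV c (cartan_diff br \<rho> f as)" for c f as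
    by (induction as arbitrary: f)
      (simp_all add: l contract_algebra grading_sign_scale,
       simp add: fun_scale_def V.scale_right_distrib)
qed

text \<open>
  With two equal leading arguments, the two terms in which \<open>t\<close> hits one of them cancel by skew symmetry.
\<close>

lemma alt_lie_deriv:
  assumes t: "linAA t" and r: "linVV r" and f: "alt f"
  shows "alt (lie_deriv t r f)"
proof (rule alternating_formI)
  note l = linFF_lie_deriv[OF r, of t]
  show "linAV (\<lambda>x. lie_deriv t r f (xs @ x # ys))" for xs ys
    using f
  proof (induction xs arbitrary: f)
    case Nil
    have "linAV (\<lambda>x. f (t x # ys))"
      by (rule linAV_I) (simp_all add: lin[OF t] lin[OF alt_lin_hd[OF Nil]])
    then show ?case
      using linFF_comp_linear[OF alt_contract_linear[OF Nil] l] by (auto intro: linAV_diff)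
  next
    case (Cons b bs)
    have "linAV (\<lambda>x. f (t b # bs @ x # ys))" using alt_lin[OF Cons.prems, of "t b # bs"] by simp
    then show ?case using Cons.IH[OF alt_contract[OF Cons.prems]] by (auto intro: linAV_diff)
  qed
  show "lie_deriv t r f (xs @ a # a # ys) = 0" for xs a ys
    using f
  proof (induction xs arbitrary: f)
    case Nil
    have "f (t a # a # ys) = - f (a # t a # ys)"
      using fun_cong[OF alt_contract_skew[OF Nil, of a "t a"], of ys] by (simp add: contract_def)
    then show ?case by (simp add: alt_contract_twice[OF Nil] lin_zero[OF l], simp add: contract_def)
  next
    case (Cons b bs)
    have "f ((t b # bs) @ a # a # ys) = 0"
      using Cons.prems unfolding alternating_form_def by blast
    then show ?case using Cons.IH[OF alt_contract[OF Cons.prems]] by simp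
  qed
qed

end

section \<open>Cartan calculus and the Chevalley-Eilenberg differential\<close>

lemma lie_deriv_grading_sign:
  assumes "Vector_Spaces.linear s s r"
  shows "lie_deriv t r (grading_sign f) = grading_sign (lie_deriv t r f)"
proof
  fix as
  note l = lin_neg[OF assms]
  have n: "lie_deriv t r (- g) bs = - lie_deriv t r g bs" for g bs
    by (induction bs arbitrary: g) (simp_all add: l contract_algebra)
  show "lie_deriv t r (grading_sign f) as = grading_sign (lie_deriv t r f) as"
    by (induction as arbitrary: f) (auto simp: grading_sign_def l n contract_grading_sign)
qed

text \<open>
  The differential raises the degree by one.
\<close>

lemma cartan_diff_local:
  assumes "\<And>bs. Suc (length bs) = length as \<Longrightarrow> f bs = 0"
    and "\<And>a. \<rho> a 0 = 0"
  shows "cartan_diff br \<rho> f as = 0"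
  using assms(1)
proof (induction as arbitrary: f)
  case (Cons a as)
  have *: "lie_deriv t (\<rho> a) g bs = 0" if "\<And>cs. length cs = length bs \<Longrightarrow> g cs = 0" for t g bs
    using that by (induction bs arbitrary: g) (simp_all add: assms(2) contract_def)
  have "lie_deriv (br a) (\<rho> a) f as = 0"
    using Cons.prems by (intro *) simp
  moreover have "cartan_diff br \<rho> (contract a f) as = 0"
    using Cons.prems by (intro Cons.IH) (simp add: contract_def)
  ultimately show ?case by (simp add: grading_sign_def)
qed simp

context coefficient_spaces
begin

text \<open>
  Derivation pairs act by a Lie algebra homomorphism.  Contracting with \<open>c\<close> reduces the claim to shorter
  lists; the mixed terms cancel, and what remains is the contraction with \<open>[t, t'] c\<close>.
\<close>
lemma lie_deriv_commutator:
  assumes r: "linVV r" and r': "linVV r'" and r'': "linVV r''"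
    and f: "alt f"
    and t'': "\<And>c. t'' c = t (t' c) - t' (t c)"
    and r_comm: "\<And>u. r'' u = r (r' u) - r' (r u)"
  shows "lie_deriv t r (lie_deriv t' r' f) as - lie_deriv t' r' (lie_deriv t r f) as
     = lie_deriv t'' r'' f as"
  using f
proof (induction as arbitrary: f)
  case Nil
  then show ?case by (simp add: r_comm)
next
  case (Cons c cs)
  note l = lin[OF linFF_lie_deriv[OF r]] lin[OF linFF_lie_deriv[OF r']]
  show ?case
    using Cons.IH[OF alt_contract[OF Cons.prems], of c]
      lin_diff[OF alt_lin_hd[OF Cons.prems], of "t (t' c)" "t' (t c)" cs]
    by (simp add: contract_lie_deriv l t'' algebra_simps)
qed

end

context lie_representation
begin

sublocale coefficient_spaces sA sV
  by unfold_locales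

lemma br_add_left: "br (a + b) c = br a c + br b c"
  and br_scale_left: "br (sA k a) c = sA k (br a c)"
  and br_add_right: "br c (a + b) = br c a + br c b"
  using lin[OF bracket_linear_left] lin[OF bracket_linear_right] by blast+

lemma br_skew: "br a b = - br b a"
proof -
  have "br a b + br b a = br (a + b) (a + b)"
    unfolding br_add_left br_add_right by (simp add: bracket_alternating)
  then have "br a b + br b a = 0" by (simp only: bracket_alternating)
  then show ?thesis by (simp add: eq_neg_iff_add_eq_0)
qed

lemma br_br: "br (br a b) c = br a (br b c) - br b (br a c)"
proof -
  have "br (br a b) c = - br c (br a b)" by (rule br_skew)
  also have "\<dots> = br a (br b c) + br b (br c a)"
    using jacobi[of a b c] by (simp add: eq_neg_iff_add_eq_0 neg_eq_iff_add_eq_0 algebra_simps)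
  also have "br b (br c a) = - br b (br a c)"
    by (subst br_skew[of c a]) (rule lin_neg[OF bracket_linear_right])
  finally show ?thesis by simp
qed

abbreviation "D \<equiv> cartan_diff br \<rho>"
abbreviation "L a \<equiv> lie_deriv (br a) (\<rho> a)"

lemma alt_L: "alt f \<Longrightarrow> alt (L a f)"
  by (rule alt_lie_deriv[OF bracket_linear_right \<rho>_endo])

lemma linFF_D: "linFF D"
  by (rule linFF_cartan_diff[OF \<rho>_endo])

lemma L_linear_in_operator:
  assumes f: "alt f"
  shows "linAV (\<lambda>a. L a f bs)"
  using f
proof (induction bs arbitrary: f)
  case Nil
  then show ?case by (simp add: \<rho>_linear)
next
  case (Cons b bs)
  have "linAV (\<lambda>a. f (br a b # bs))"
    by (rule linAV_I) (simp_all add: br_add_left br_scale_left lin[OF alt_lin_hd[OF Cons.prems]])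
  then show ?case using Cons.IH[OF alt_contract[OF Cons.prems]] by (auto intro: linAV_diff)
qed

lemma linAV_grading_sign: "(\<And>as. linAV (\<lambda>x. G x as)) \<Longrightarrow> linAV (\<lambda>x. grading_sign (G x) as)"
  by (cases "even (length as)") (simp_all add: grading_sign_def linAV_neg)

text \<open>
  For two equal leading arguments \<open>a\<close>, the terms \<open>i\<^sub>a i\<^sub>a f\<close> and the contraction with \<open>[a,a]\<close> vanish; the Lie
  derivatives along \<open>a\<close> occur in two neighbouring degrees, hence with opposite signs.
\<close>

lemma alt_D:
  assumes f: "alt f" shows "alt (D f)"
proof (rule alternating_formI)
  show "linAV (\<lambda>x. D f (xs @ x # ys))" for xs ys
    using f
  proof (induction xs arbitrary: f)
    case Nil
    show ?case
      using linFF_comp_linear[OF alt_contract_linear[OF Nil] linFF_D]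
        linAV_grading_sign[of "\<lambda>x. L x f", OF L_linear_in_operator[OF Nil]]
      by (auto intro: linAV_add)
  next
    case (Cons b bs)
    show ?case
      using Cons.IH[OF alt_contract[OF Cons.prems]]
        alt_lin[OF alt_grading_sign[OF alt_L[OF Cons.prems, of b]]]
      by (auto intro: linAV_add)
  qed
  show "D f (xs @ a # a # ys) = 0" for xs a ys
    using f
  proof (induction xs arbitrary: f)
    case Nil
    have [simp]: "f (0 # ys) = 0" by (rule lin_zero[OF alt_lin_hd[OF Nil]])
    show ?case
      by (simp add: alt_contract_twice[OF Nil] lin[OF linFF_D] bracket_alternating grading_sign_def)
  next
    case (Cons b bs)
    show ?case
      using Cons.IH[OF alt_contract[OF Cons.prems]]
        alt_adjacent[OF alt_grading_sign[OF alt_L[OF Cons.prems, of b]]]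
      by simp
  qed
qed

text \<open>
  Invariance of the differential under derivation pairs.  After contracting with \<open>a\<close>, the failure of \<open>t\<close>
  to fix \<open>a\<close> is compensated by the commutator of the derivation action with \<open>L\<^sub>a\<close>, which is \<open>L\<^bsub>t a\<^esub>\<close>.  Inner
  derivations are used for \<open>D D = 0\<close>, and \<open>(d, d\<^sub>V)\<close> for the outer mapping cone.
\<close>

lemma lie_deriv_D:
  assumes t: "linAA t" and r: "linVV r"
    and t_br: "\<And>a b. t (br a b) = br (t a) b + br a (t b)"
    and r_\<rho>: "\<And>a u. r (\<rho> a u) = \<rho> (t a) u + \<rho> a (r u)"
    and f: "alt f"
  shows "lie_deriv t r (D f) = D (lie_deriv t r f)"
proof
  fix as
  show "lie_deriv t r (D f) as = D (lie_deriv t r f) as"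
    using f
  proof (induction as arbitrary: f)
    case Nil
    then show ?case by (simp add: lin_zero[OF r])
  next
    case (Cons a as)
    have c: "lie_deriv t r (L a f) = L (t a) f + L a (lie_deriv t r f)"
      using lie_deriv_commutator[OF r \<rho>_endo \<rho>_endo Cons.prems, of "br (t a)" t "br a" "t a" a]
      by (auto simp: fun_eq_iff t_br r_\<rho> algebra_simps)
    show ?case
      by (simp add: Cons.IH[OF alt_contract[OF Cons.prems]] contract_lie_deriv contract_cartan_diff
          lin[OF linFF_lie_deriv[OF r]] lin[OF linFF_D] lie_deriv_grading_sign[OF r] c
          grading_sign_algebra)
  qed
qed

lemma L_D: "alt f \<Longrightarrow> L a (D f) = D (L a f)"
  by (rule lie_deriv_D[OF bracket_linear_right \<rho>_endo])
    (simp_all add: br_br \<rho>_bracket)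

lemma D_grading_sign: "D (grading_sign f) as = - grading_sign (D f) as"
proof (induction as arbitrary: f)
  case (Cons a as)
  then show ?case
    by (simp add: contract_grading_sign lin[OF linFF_D] lie_deriv_grading_sign[OF \<rho>_endo])
      (simp add: grading_sign_def)
qed (simp add: grading_sign_def)

text \<open>
  \<open>i\<^sub>a D D = D D i\<^sub>a + D S L\<^sub>a + S L\<^sub>a D\<close> for the degree sign \<open>S\<close>; the last two terms cancel because \<open>D\<close>
  anticommutes with \<open>S\<close> and commutes with \<open>L\<^sub>a\<close>.
\<close>

lemma D_D:
  assumes "alt f" shows "D (D f) = 0"
proof
  fix as
  show "D (D f) as = 0 as"
    using assms
  proof (induction as arbitrary: f)
    case (Cons a as)
    show ?case
      using Cons.IH[OF alt_contract[OF Cons.prems]]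
      by (simp add: contract_cartan_diff lin[OF linFF_D] D_grading_sign L_D[OF Cons.prems])
  qed simp
qed

end

lemma cartan_diff_homogeneous:
  assumes "\<And>bs. length bs \<noteq> n \<Longrightarrow> f bs = 0" "\<And>a. \<rho> a 0 = 0" "length as \<noteq> n + 1"
  shows "cartan_diff br \<rho> f as = 0"
  using assms by (intro cartan_diff_local) auto

section \<open>Twisting by a square root of the negative weight\<close>

text \<open>
  Let \<open>\<mu>\<^sup>2 = - \<lambda>\<close> and split \<open>f ((R + \<mu>) a\<^sub>1, \<dots>, (R + \<mu>) a\<^sub>n) = E + \<mu> O\<close> into its even and odd part in \<open>\<mu>\<close>.
  Then \<open>twist sV \<lambda> R p q f\<close> is \<open>p E + q O\<close>.  Prepending an argument \<open>a\<close> gives one summand with \<open>R a\<close> and one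
  with \<open>\<mu> a\<close>; multiplication by \<open>\<mu>\<close> sends \<open>(E, O)\<close> to \<open>(- \<lambda> O, E)\<close>, that is, \<open>(p, q)\<close> to \<open>(q, - \<lambda> p)\<close>.
\<close>

fun twist ::
  "('k \<Rightarrow> 'v \<Rightarrow> 'v) \<Rightarrow> 'k::field \<Rightarrow> ('a \<Rightarrow> 'a) \<Rightarrow> ('v \<Rightarrow> 'v) \<Rightarrow> ('v \<Rightarrow> 'v)
    \<Rightarrow> ('a list \<Rightarrow> 'v::ab_group_add) \<Rightarrow> 'a list \<Rightarrow> 'v" where
  "twist sV lam R p q f [] = p (f [])"
| "twist sV lam R p q f (a # as) =
     twist sV lam R p q (contract (R a) f) as
     + twist sV lam R q (\<lambda>u. sV (- lam) (p u)) (contract a f) as"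

lemma contract_twist:
  "contract a (twist sV lam R p q f) =
     twist sV lam R p q (contract (R a) f)
     + twist sV lam R q (\<lambda>u. sV (- lam) (p u)) (contract a f)"
  by (rule ext) (simp add: contract_def)

context coefficient_spaces
begin

context
  notes V.scale_minus_left [simp del]
begin

lemma linVV_scale: "linVV p \<Longrightarrow> linVV (\<lambda>u. sV c (p u))"
  using V.vector_space_axioms
  by (simp add: Vector_Spaces.linear_iff V.scale_right_distrib mult.commute)

lemma linFF_twist:
  assumes p: "linVV p" and q: "linVV q" shows "linFF (twist sV lam R p q)"
proof (rule linFF_I)
  show "twist sV lam R p q (f + g) as = twist sV lam R p q f as + twist sV lam R p q g as" for f g as
    using p q by (induction as arbitrary: f g p q) (simp_all add: lin_add linVV_scale contract_algebra)
  show "twist sV lam R p q (fun_scale sV c f) as = sV c (twist sV lam R p q f as)" for c f as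
    using p q
  proof (induction as arbitrary: f p q)
    case Nil
    then show ?case by (simp add: lin_scale fun_scale_def)
  next
    case (Cons a as)
    then show ?case by (simp add: linVV_scale contract_algebra V.scale_right_distrib)
  qed
qed

lemma twist_scale:
  assumes p: "linVV p" and q: "linVV q"
  shows "twist sV lam R (\<lambda>u. sV c (p u)) (\<lambda>u. sV c (q u)) f as = sV c (twist sV lam R p q f as)"
  using p q
proof (induction as arbitrary: f p q)
  case (Cons a as)
  have "(\<lambda>u. sV (- lam) (sV c (p u))) = (\<lambda>u. sV c (sV (- lam) (p u)))"
    by (simp add: mult.commute)
  then show ?case
    using Cons by (simp only: twist.simps Cons.IH linVV_scale V.scale_right_distrib)
qed simp

text \<open>
  For two equal leading arguments \<open>a\<close> the arguments \<open>(R a, R a)\<close> and \<open>(a, a)\<close> contribute zero, and the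
  contributions of \<open>(R a, a)\<close> and \<open>(a, R a)\<close> cancel.
\<close>

lemma alt_twist:
  assumes R: "linAA R" and p: "linVV p" and q: "linVV q" and f: "alt f"
  shows "alt (twist sV lam R p q f)"
proof (rule alternating_formI)
  show "linAV (\<lambda>x. twist sV lam R p q f (xs @ x # ys))" for xs ys
    using p q f
  proof (induction xs arbitrary: f p q)
    case Nil
    have *: "Vector_Spaces.linear sA (fun_scale sV) (\<lambda>x. contract (R x) f)"
      using alt_contract_linear[OF Nil(3)] R by (simp add: Vector_Spaces.linear_iff)
    show ?case
      using Nil linFF_comp_linear[OF * linFF_twist]
        linFF_comp_linear[OF alt_contract_linear[OF Nil(3)] linFF_twist]
      by (auto intro!: linAV_add simp: linVV_scale)
  next
    case (Cons b bs)
    then show ?case by (auto intro!: linAV_add simp: linVV_scale alt_contract)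
  qed
  show "twist sV lam R p q f (xs @ a # a # ys) = 0" for xs a ys
    using p q f
  proof (induction xs arbitrary: f p q)
    case Nil
    note l = lin[OF linFF_twist]
    show ?case
      using Nil alt_contract_skew[OF Nil(3), of a "R a"]
      by (simp add: alt_contract_twice l linVV_scale)
  next
    case (Cons b bs)
    then show ?case by (simp add: linVV_scale alt_contract)
  qed
qed

lemma lie_deriv_zero: "lie_deriv (\<lambda>_. 0) (\<lambda>_. 0) f as = 0" if "alt f"
  using that
  by (induction as arbitrary: f) (simp_all add: alt_contract lin_zero[OF alt_lin_hd])

text \<open>
  The assumptions on \<open>t'\<close> say that \<open>(R + \<mu>) t' = (ta + \<mu> tb) (R + \<mu>)\<close>, and those on \<open>r'\<close> say that \<open>r'\<close>
  corresponds to \<open>ra + \<mu> rb\<close> under \<open>(p, q)\<close>; so the twist carries the action of \<open>(ta, ra) + \<mu> (tb, rb)\<close>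
  to that of \<open>(t', r')\<close>.  With \<open>ta = [R a, \<cdot>]\<close>, \<open>tb = [a, \<cdot>]\<close> this compares Lie derivatives on \<open>A\<close> and on the
  descendent algebra; with \<open>ta = d\<close>, \<open>tb = 0\<close> it gives the compatibility with \<open>\<Delta>\<close>.  The pair \<open>(p, q)\<close> is
  arbitrary because the induction replaces it by \<open>(q, - \<lambda> p)\<close>.
\<close>

lemma lie_deriv_twist:
  assumes p: "linVV p" and q: "linVV q"
    and r': "linVV r'" and ra: "linVV ra" and rb: "linVV rb" and f: "alt f"
    and Rt': "\<And>b. R (t' b) = ta (R b) - sA lam (tb b)"
    and t': "\<And>b. t' b = ta b + tb (R b)"
    and r'p: "\<And>u. r' (p u) = p (ra u) + q (rb u)"
    and r'q: "\<And>u. r' (q u) = q (ra u) - sV lam (p (rb u))"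
  shows "lie_deriv t' r' (twist sV lam R p q f) as =
    twist sV lam R p q (lie_deriv ta ra f) as
    + twist sV lam R q (\<lambda>u. sV (- lam) (p u)) (lie_deriv tb rb f) as"
  using p q f r'p r'q
proof (induction as arbitrary: f p q)
  case Nil
  then show ?case by simp
next
  case (Cons b bs)
  let ?p' = "\<lambda>u. sV (- lam) (p u)" and ?q' = "\<lambda>u. sV (- lam) (q u)"
  let ?T = "twist sV lam R"
  note pq = Cons.prems(1,2)
  have p'q': "linVV ?p'" "linVV ?q'" using pq by (simp_all only: linVV_scale)
  note l = lin[OF linFF_twist[OF pq]] lin[OF linFF_twist[OF pq(2) p'q'(1)]]
    lin[OF linFF_lie_deriv[OF r']]
  note c = lin[OF alt_contract_linear[OF Cons.prems(3)]]
  \<comment> \<open>Multiplying twice by \<open>\<mu>\<close> is multiplication by \<open>- \<lambda>\<close>.\<close>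
  have T': "?T ?p' ?q' g as = - sV lam (?T p q g as)" for g as
    using twist_scale[OF pq, of lam R "- lam" g as] by (simp add: V.scale_minus_left)
  have IH1: "lie_deriv t' r' (?T p q g) bs = ?T p q (lie_deriv ta ra g) bs + ?T q ?p' (lie_deriv tb rb g) bs"
    if "alt g" for g
    by (rule Cons.IH) (use pq that Cons.prems in auto)
  have IH2: "lie_deriv t' r' (?T q ?p' g) bs = ?T q ?p' (lie_deriv ta ra g) bs + ?T ?p' ?q' (lie_deriv tb rb g) bs"
    if "alt g" for g
    by (rule Cons.IH)
      (use pq p'q' that Cons.prems(4,5) in \<open>auto simp: lin[OF r'] V.scale_minus_left V.scale_right_distrib\<close>)
  have R': "R (ta b + tb (R b)) = ta (R b) - sA lam (tb b)"
    using Rt'[of b] by (simp add: t'[of b])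
  show ?case
    using Cons.prems(3) T'
    by (simp add: contract_twist contract_lie_deriv l IH1 IH2 alt_contract R' t'[of b] c algebra_simps,
        simp add: fun_scale_def)
qed

end

end

section \<open>Explicit sums\<close>

lemma lie_deriv_eq_sum:
  "lie_deriv t r f as = r (f as) - (\<Sum>i<length as. f (as[i := t (as ! i)]))"
proof (induction as arbitrary: f)
  case (Cons a as)
  then show ?case
    by (simp add: contract_def sum.lessThan_Suc_shift del: sum.lessThan_Suc)
qed simp

text \<open>
  The coefficient with which a summand having \<open>r\<close> untwisted arguments occurs in \<open>twist\<close>.
\<close>

definition twist_coeff :: "('k::field \<Rightarrow> 'v \<Rightarrow> 'v) \<Rightarrow> 'k \<Rightarrow> ('v \<Rightarrow> 'v) \<Rightarrow> ('v \<Rightarrow> 'v) \<Rightarrow> nat \<Rightarrow> 'v \<Rightarrow> 'v"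
  where "twist_coeff sV lam p q r u =
    (if even r then sV ((- lam) ^ (r div 2)) (p u) else sV ((- lam) ^ ((r - 1) div 2)) (q u))"

lemma R_except_Cons:
  "R_except R I (a # as) = (if 0 \<in> I then a else R a) # R_except R {k. Suc k \<in> I} as"
  unfolding R_except_def by (simp add: upt_conv_Cons map_Suc_upt[symmetric] o_def del: upt_Suc)

lemma sum_Pow_lessThan_Suc:
  fixes F :: "nat set \<Rightarrow> 'b::comm_monoid_add"
  shows "(\<Sum>I\<in>Pow {..<Suc n}. F I) =
     (\<Sum>J\<in>Pow {..<n}. F (Suc ` J)) + (\<Sum>J\<in>Pow {..<n}. F (insert 0 (Suc ` J)))"
proof -
  have "(\<Sum>I\<in>Pow {..<Suc n}. F I) = (\<Sum>I\<in>Pow (Suc ` {..<n}). F I) + (\<Sum>I\<in>insert 0 ` Pow (Suc ` {..<n}). F I)"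
    unfolding lessThan_Suc_eq_insert_0 Pow_insert by (rule sum.union_disjoint) auto
  moreover have "(\<Sum>I\<in>insert 0 ` Pow (Suc ` {..<n}). F I) = (\<Sum>I\<in>Pow (Suc ` {..<n}). F (insert 0 I))"
    by (rule sum.reindex_cong[where l = "insert 0"]) (auto simp: inj_on_def)
  moreover have "(\<Sum>I\<in>Pow (Suc ` {..<n}). G I) = (\<Sum>J\<in>Pow {..<n}. G (Suc ` J))" for G :: "nat set \<Rightarrow> 'b"
    by (rule sum.reindex_cong[where l = "image Suc"])
      (auto simp: inj_on_def inj_image_eq_iff image_Pow_surj)
  ultimately show ?thesis by simp
qed

context coefficient_spaces
begin

lemma twist_eq_sum:
  "twist sV lam R p q f as =
     (\<Sum>I\<in>Pow {..<length as}. twist_coeff sV lam p q (card I) (f (R_except R I as)))"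
proof (induction as arbitrary: f p q)
  case Nil
  show ?case by (simp add: twist_coeff_def R_except_def)
next
  case (Cons a as)
  have S: "card (Suc ` J) = card J" for J by (simp add: card_image)
  have I: "card (insert 0 (Suc ` J)) = Suc (card J)" if "J \<in> Pow {..<length as}" for J
    using that by (subst card_insert_disjoint) (auto simp: card_image intro: finite_subset)
  \<comment> \<open>One more untwisted argument shifts \<open>(p, q)\<close> to \<open>(q, - \<lambda> p)\<close>, as in the recursion of the twist.\<close>
  have step: "twist_coeff sV lam p q (Suc k) u = twist_coeff sV lam q (\<lambda>u. sV (- lam) (p u)) k u" for k u
  proof (cases "even k")
    case False
    then obtain m where "k = 2 * m + 1" by (auto elim: oddE)
    then show ?thesis by (simp add: twist_coeff_def mult.commute)
  qed (simp add: twist_coeff_def)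
  have shift: "{k. Suc k \<in> Suc ` J} = J" "{k. Suc k \<in> insert 0 (Suc ` J)} = J" for J by auto
  show ?case
    unfolding length_Cons sum_Pow_lessThan_Suc twist.simps Cons.IH
    by (intro arg_cong2[where f = "(+)"] sum.cong refl)
      (simp_all add: R_except_Cons S I step shift contract_def)
qed

text \<open>
  The pair \<open>(id, - R\<^sub>V)\<close> is the \<open>\<mu>\<close>-component of \<open>\<mu> - R\<^sub>V\<close>.  Compared with the sum over all index sets,
  the even part of \<open>phi\<close> lists the empty set separately as \<open>f (R a\<^sub>1, \<dots>, R a\<^sub>n)\<close>.
\<close>

lemma phi_eq_twist:
  assumes f: "\<And>as. length as \<noteq> n \<Longrightarrow> f as = 0" and RV: "linVV RV"
  shows "phi sV lam R RV n f = twist sV lam R id (\<lambda>u. - RV u) f"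
proof
  fix as
  let ?T = "twist sV lam R id (\<lambda>u. - RV u) f as"
  have pow0: "twist_coeff sV lam id (\<lambda>u. - RV u) k 0 = 0" for k
    using RV by (simp add: twist_coeff_def lin_zero)
  have len: "length (R_except R I as) = length as" for I by (simp add: R_except_def)
  show "phi sV lam R RV n f as = ?T"
  proof (cases "length as = n")
    case False
    then have "f as = 0" "f (R_except R I as) = 0" for I using f len by auto
    then show ?thesis using False by (simp add: twist_eq_sum pow0 len phi_def on_tuples_def)
  next
    case n: True
    show ?thesis
    proof (cases "n = 0")
      case True
      then show ?thesis using n by (simp add: phi_def)
    next
      case False
      let ?F = "\<lambda>I. twist_coeff sV lam id (\<lambda>u. - RV u) (card I) (f (R_except R I as))"
      let ?O = "{I. I \<subseteq> {..<n} \<and> odd (card I)}" and ?E = "{I. I \<subseteq> {..<n} \<and> card I \<ge> 2 \<and> even (card I)}"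
      have fin: "finite I" if "I \<subseteq> {..<n}" for I using that by (rule finite_subset) simp
      have "card I \<ge> 2" if "I \<subseteq> {..<n}" "I \<noteq> {}" "even (card I)" for I
      proof -
        have "card I \<noteq> 0" using that fin[of I] by simp
        with \<open>even (card I)\<close> show ?thesis by presburger
      qed
      then have split: "Pow {..<n} = insert {} (?O \<union> ?E)" by auto
      have fO: "finite ?O" "finite ?E" by (auto intro: finite_subset[of _ "Pow {..<n}"])
      have "?T = sum ?F (insert {} (?O \<union> ?E))" by (simp add: twist_eq_sum n split)
      also have "\<dots> = ?F {} + (sum ?F ?O + sum ?F ?E)"
        using fO by (subst sum.insert) (auto simp: sum.union_disjoint[symmetric] intro!: sum.union_disjoint)
      also have "?F {} = f (map R as)"
      proof -
        have "R_except R {} as = map R as" by (rule nth_equalityI) (simp_all add: R_except_def)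
        then show ?thesis by (simp add: twist_coeff_def)
      qed
      also have "sum ?F ?O = - (\<Sum>I\<in>?O. sV ((- lam) ^ ((card I - 1) div 2)) (RV (f (R_except R I as))))"
        unfolding sum_negf[symmetric] by (rule sum.cong) (simp_all add: twist_coeff_def)
      also have "sum ?F ?E = (\<Sum>I\<in>?E. sV ((- lam) ^ (card I div 2)) (f (R_except R I as)))"
        by (rule sum.cong) (simp_all add: twist_coeff_def)
      finally show ?thesis using n False by (simp add: phi_def on_tuples_def id_def algebra_simps)
    qed
  qed
qed

lemma alt_move_to_position:
  assumes "alt f" "j < length as"
  shows "f (x # nths as (- {j})) = sV ((-1) ^ j) (f (as[j := x]))"
  using assms
proof (induction as arbitrary: f j)
  case (Cons b bs)
  show ?case
  proof (cases j)
    case 0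
    have "{k. k \<noteq> (0::nat)} = - {0}" by auto
    then show ?thesis using 0 by (simp add: nths_Cons nths_all)
  next
    case (Suc k)
    have "nths (b # bs) (- {j}) = b # nths bs (- {k})"
      by (simp add: nths_Cons Suc Compl_eq)
    then have "f (x # nths (b # bs) (- {j})) = contract b (contract x f) (nths bs (- {k}))"
      by (simp add: contract_def)
    also have "\<dots> = - contract b f (x # nths bs (- {k}))"
      by (simp add: alt_contract_skew[OF Cons.prems(1), of b x], simp add: contract_def)
    also have "\<dots> = - sV ((-1) ^ k) (contract b f (bs[k := x]))"
      using Cons.prems Suc by (subst Cons.IH) (auto intro: alt_contract)
    finally show ?thesis using Suc by (simp add: contract_def)
  qed
qed simp

end

context lie_representation
begin

text \<open>
  Split off the terms of the coboundary that involve the first argument \<open>a\<close>: the term with \<open>\<rho> a\<close> and those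
  with \<open>[a, a\<^sub>j]\<close>, moved to position \<open>j\<close>, form the Lie derivative along \<open>a\<close>.  The others form the coboundary of
  \<open>i\<^sub>a f\<close>, after exchanging \<open>a\<close> with the bracket in front of it.
\<close>

lemma D_eq_sum:
  assumes "alt f"
  shows "D f as =
     (\<Sum>i<length as. sV ((-1) ^ (i + length as)) (\<rho> (as ! i) (f (nths as (- {i}))))) +
     (\<Sum>j<length as. \<Sum>i<j. sV ((-1) ^ (i + j + length as))
        (f (br (as ! i) (as ! j) # nths as (- {i, j}))))"
  using assms
proof (induction as arbitrary: f)
  case (Cons a as)
  let ?n = "length as"
  have cf: "contract a f = (\<lambda>bs. f (a # bs))" by (rule ext) (simp add: contract_def)
  have n0: "nths (a # as) (- {0}) = as" by (simp add: nths_Cons nths_all)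
  have n1: "nths (a # as) (- {Suc i}) = a # nths as (- {i})" for i
    by (simp add: nths_Cons Compl_eq)
  have n2: "nths (a # as) (- {0, Suc j}) = nths as (- {j})" for j
    by (simp add: nths_Cons Compl_eq)
  have n3: "nths (a # as) (- {Suc i, Suc j}) = a # nths as (- {i, j})" for i j
    by (simp add: nths_Cons Compl_eq)
  have skew: "f (x # a # xs) = - f (a # x # xs)" for x xs
    using fun_cong[OF alt_contract_skew[OF Cons.prems, of a x], of xs] by (simp add: contract_def)
  have moved: "(\<Sum>j<?n. sV ((-1) ^ (j + ?n)) (f (br a (as ! j) # nths as (- {j}))))
    = sV ((-1) ^ ?n) (\<Sum>j<?n. f (as[j := br a (as ! j)]))"
    unfolding V.scale_sum_right
    by (rule sum.cong) (simp_all add: alt_move_to_position[OF Cons.prems] minus_one_power_iff)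
  have "grading_sign (L a f) as = sV ((-1) ^ Suc ?n) (\<rho> a (f as)) + sV ((-1) ^ ?n) (\<Sum>j<?n. f (as[j := br a (as ! j)]))"
    by (simp add: grading_sign_def lie_deriv_eq_sum)
  also note moved[symmetric]
  finally show ?case
    using Cons.IH[of "contract a f", OF alt_contract[OF Cons.prems]]
    by (simp add: sum.lessThan_Suc_shift n0 n1 n2 n3 skew sum.distrib cf algebra_simps
      del: sum.lessThan_Suc)
qed simp

lemma CE_coboundary_eq_D:
  assumes "f \<in> alt_maps sA sV n" and "alt f"
  shows "CE_coboundary sV br \<rho> n f = D f"
proof
  fix as
  have "\<And>bs. length bs \<noteq> n \<Longrightarrow> f bs = 0" using assms by (simp add: alt_maps_def)
  then have "D f as = 0" if "length as \<noteq> n + 1"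
    using that lin_zero[OF \<rho>_endo] by (intro cartan_diff_homogeneous) auto
  moreover have "CE_coboundary sV br \<rho> n f as = D f as" if "length as = n + 1"
    using that unfolding D_eq_sum[OF assms(2)] CE_coboundary_def on_tuples_def
    by (simp add: algebra_simps del: sum.lessThan_Suc)
  ultimately show "CE_coboundary sV br \<rho> n f as = D f as"
    by (cases "length as = n + 1") (simp_all add: CE_coboundary_def on_tuples_def)
qed

end

context coefficient_spaces
begin

text \<open>
  For the converse direction, two equal entries are brought next to each other: contracting removes the
  arguments in front of the first of them, and moving the second one forward changes only the sign.
\<close>

lemma alt_maps_iff: "f \<in> alt_maps sA sV n \<longleftrightarrow> alt f \<and> (\<forall>as. length as \<noteq> n \<longrightarrow> f as = 0)"
proof
  assume f: "f \<in> alt_maps sA sV n"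
  have "linAV (\<lambda>x. f (xs @ x # ys))" for xs ys
  proof (cases "length (xs @ undefined # ys) = n")
    case True
    have "\<forall>as i. length as = n \<and> i < n \<longrightarrow> linAV (\<lambda>x. f (as[i := x]))"
      using f unfolding alt_maps_def mem_Collect_eq by blast
    from this[rule_format, of "xs @ undefined # ys" "length xs"] True show ?thesis
      by (simp add: list_update_append)
  next
    case False
    then have "f (xs @ x # ys) = 0" for x using f by (simp add: alt_maps_def)
    then show ?thesis by (simp add: linAV_zero)
  qed
  moreover have "f (xs @ a # a # ys) = 0" for xs a ys
  proof (cases "length (xs @ a # a # ys) = n")
    case True
    have "\<forall>as i j. length as = n \<and> i < j \<and> j < n \<and> as ! i = as ! j \<longrightarrow> f as = 0"
      using f unfolding alt_maps_def mem_Collect_eq by blast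
    from this[rule_format, of "xs @ a # a # ys" "length xs" "Suc (length xs)"] show ?thesis
      using True by (simp add: nth_append)
  next
    case False
    then show ?thesis using f by (simp add: alt_maps_def)
  qed
  ultimately have "alt f" by (rule alternating_formI)
  then show "alt f \<and> (\<forall>as. length as \<noteq> n \<longrightarrow> f as = 0)"
    using f unfolding alt_maps_def mem_Collect_eq by blast
next
  assume *: "alt f \<and> (\<forall>as. length as \<noteq> n \<longrightarrow> f as = 0)"
  have "linAV (\<lambda>x. f (as[i := x]))" if "i < length as" for as i
    unfolding upd_conv_take_nth_drop[OF that] using * by (intro alt_lin) blast
  moreover have "f as = 0" if "i < j" "j < length as" "as ! i = as ! j" for as i j
    using that *[THEN conjunct1]
  proof (induction i arbitrary: as f j)
    case 0
    obtain a bs where as: "as = a # bs" using 0 by (cases as) auto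
    obtain k where j: "j = Suc k" using 0 by (cases j) auto
    have k: "k < length bs" "bs ! k = a" using 0 as j by auto
    have "f as = sV ((-1) ^ k) (f (a # a # nths bs (- {k})))"
      using alt_move_to_position[OF alt_contract[OF 0(4), of a] k(1), of a]
        list_update_id[of bs k, unfolded k(2)]
      by (simp add: contract_def as minus_one_power_iff)
    then show ?case using alt_adjacent[OF 0(4), of "[]"] by simp
  next
    case (Suc i)
    obtain a bs where as: "as = a # bs" using Suc.prems by (cases as) auto
    obtain k where j: "j = Suc k" using Suc.prems by (cases j) auto
    have "contract a f bs = 0"
      by (rule Suc.IH[of k]) (use Suc.prems as j in \<open>simp_all add: alt_contract\<close>)
    then show ?case by (simp add: as contract_def)
  qed
  ultimately show "f \<in> alt_maps sA sV n"
    unfolding alt_maps_def mem_Collect_eq using *[THEN conjunct2] by blast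
qed

lemma twist_local:
  assumes p: "linVV p" and q: "linVV q" and f: "\<And>bs. length bs = length as \<Longrightarrow> f bs = 0"
  shows "twist sV lam R p q f as = 0"
  using p q f
proof (induction as arbitrary: f p q)
  case (Cons a as)
  have "linVV (\<lambda>u. sV (- lam) (p u))" by (rule linVV_scale) fact
  then show ?case using Cons by (simp add: contract_def)
qed (simp add: lin_zero)

lemma lie_deriv_local:
  assumes r: "linVV r" and f: "\<And>bs. length bs = length as \<Longrightarrow> f bs = 0"
  shows "lie_deriv t r f as = 0"
  using f by (simp add: lie_deriv_eq_sum lin_zero[OF r])

lemma Delta_eq_lie_deriv:
  assumes "f \<in> alt_maps sA sV n" "linVV r"
  shows "Delta t r n f = - lie_deriv t r f"
  using assms by (auto simp: fun_eq_iff Delta_def on_tuples_def lie_deriv_eq_sum alt_maps_def lin_zero)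

end

section \<open>The descendent Lie algebra and the chain map\<close>

context mRB_LieDer_representation
begin

abbreviation "brR a b \<equiv> br (R a) b + br a (R b)"
abbreviation "\<rho>R a u \<equiv> \<rho> (R a) u - R\<^sub>V (\<rho> a u)"

lemmas linearities = lin[OF bracket_linear_left] lin[OF bracket_linear_right]
  lin[OF R_linear] lin[OF RV_linear] lin[OF \<rho>_linear] lin[OF \<rho>_endo] lin[OF d_linear] lin[OF dV_linear]

text \<open>
  The modified Rota-Baxter equation turns each term \<open>R [a,b]\<^sub>R\<close> into \<open>[R a, R b] - \<lambda> [a,b]\<close>.  The Jacobi
  identity for \<open>[\<cdot>,\<cdot>]\<^sub>R\<close> then splits into the Jacobi identities for the triples with two entries under \<open>R\<close>
  and \<open>- \<lambda>\<close> times the one for \<open>(a, b, c)\<close>.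
\<close>

lemma descendent_representation: "lie_representation sA brR sV \<rho>R"
proof (intro lie_representation.intro lie_algebra.intro lie_algebra_axioms.intro
    lie_representation_axioms.intro)
  fix a b c :: 'a and u :: 'v
  have br_R: "R (brR a b) = br (R a) (R b) - sA lam (br a b)" for a b
    by (simp add: modified_Rota_Baxter)
  show "vector_space sA" "vector_space sV" by unfold_locales
  show "linAA (brR a)"
    using vector_space_axioms
    by (simp add: Vector_Spaces.linear_iff linearities algebra_simps scale_right_distrib)
  show "linAA (\<lambda>a. brR a b)"
    using vector_space_axioms
    by (simp add: Vector_Spaces.linear_iff linearities algebra_simps scale_right_distrib)
  show "brR a a = 0" using br_skew[of a "R a"] by simp
  have J: "brR a (brR b c) = br (R a) (br (R b) c) + br (R a) (br b (R c))
      + br a (br (R b) (R c)) - sA lam (br a (br b c))" for a b c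
    by (simp only: br_R) (simp add: linearities)
  have "brR a (brR b c) + brR b (brR c a) + brR c (brR a b) =
      (br (R a) (br (R b) c) + br (R b) (br c (R a)) + br c (br (R a) (R b)))
    + (br (R a) (br b (R c)) + br b (br (R c) (R a)) + br (R c) (br (R a) b))
    + (br a (br (R b) (R c)) + br (R b) (br (R c) a) + br (R c) (br a (R b)))
    - sA lam (br a (br b c) + br b (br c a) + br c (br a b))"
    unfolding J by (simp add: scale_right_distrib algebra_simps)
  then show "brR a (brR b c) + brR b (brR c a) + brR c (brR a b) = 0"
    by (simp only: jacobi) simp
  show "linVV (\<rho>R a)"
    using V.vector_space_axioms
    by (simp add: Vector_Spaces.linear_iff linearities V.scale_right_diff_distrib)
  show "linAV (\<lambda>a. \<rho>R a u)"
    by (rule linAV_I) (simp_all add: linearities V.scale_right_diff_distrib)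
  show "\<rho>R (brR a b) u = \<rho>R a (\<rho>R b u) - \<rho>R b (\<rho>R a u)"
    by (simp only: br_R) (simp add: linearities \<rho>_bracket \<rho>_RV V.scale_right_diff_distrib algebra_simps)
qed

sublocale descendent: lie_representation sA brR sV \<rho>R
  by (rule descendent_representation)

abbreviation "DR \<equiv> cartan_diff brR \<rho>R"
abbreviation "tw \<equiv> twist sV lam R"

lemma grading_sign_twist:
  assumes "linVV p" "linVV q"
  shows "tw p q (grading_sign f) as = grading_sign (tw p q f) as"
proof -
  have n: "tw p q (- g) as = - tw p q g as" if "linVV p" "linVV q" for p q g as
    using lin_neg[OF linFF_twist[OF that]] by simp
  show ?thesis
    using assms
  proof (induction as arbitrary: f p q)
    case (Cons a as)
    have "linVV (\<lambda>u. sV (- lam) (p u))" by (rule linVV_scale) fact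
    then show ?case
      using Cons n
      by (simp add: contract_grading_sign del: V.scale_minus_left)
        (simp add: grading_sign_def del: V.scale_minus_left)
  qed (simp add: grading_sign_def lin_neg)
qed

text \<open>
  The assumptions on \<open>(p, q)\<close> say that \<open>\<rho>\<^sub>R a\<close> corresponds to \<open>\<rho> ((R + \<mu>) a)\<close>; they are inherited by
  \<open>(q, - \<lambda> p)\<close>.  After contracting with \<open>a\<close>, the induction hypotheses handle the two summands of the
  twist, and the Lie derivatives on both sides agree by \<open>lie_deriv_twist\<close>.
\<close>

lemma twist_chain_map:
  assumes p: "linVV p" and q: "linVV q" and f: "alt f"
    and \<rho>p: "\<And>a u. \<rho>R a (p u) = p (\<rho> (R a) u) + q (\<rho> a u)"
    and \<rho>q: "\<And>a u. \<rho>R a (q u) = q (\<rho> (R a) u) - sV lam (p (\<rho> a u))"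
  shows "DR (tw p q f) as = tw p q (D f) as"
  using p q f \<rho>p \<rho>q
proof (induction as arbitrary: f p q)
  case Nil
  then show ?case by (simp add: lin_zero)
next
  case (Cons a as)
  let ?p' = "\<lambda>u. sV (- lam) (p u)"
  note pq = Cons.prems(1,2) and f = Cons.prems(3)
  have p': "linVV ?p'" using pq(1) by (rule linVV_scale)
  have LR: "descendent.L a (tw p q f) = tw p q (L (R a) f) + tw q ?p' (L a f)"
  proof
    fix as
    show "descendent.L a (tw p q f) as = (tw p q (L (R a) f) + tw q ?p' (L a f)) as"
      using lie_deriv_twist[OF pq descendent.\<rho>_endo \<rho>_endo \<rho>_endo f,
          where lam = lam and R = R and t' = "brR a" and ta = "br (R a)" and tb = "br a"]
        Cons.prems(4,5)
      by (simp add: modified_Rota_Baxter)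
  qed
  have \<rho>p': "\<rho>R b (?p' u) = ?p' (\<rho> (R b) u) - sV lam (q (\<rho> b u))" for b u
  proof -
    have "\<rho>R b (?p' u) = sV (- lam) (\<rho>R b (p u))"
      by (rule lin_scale[OF descendent.\<rho>_endo])
    then show ?thesis by (simp only: Cons.prems(4) V.scale_right_distrib) simp
  qed
  have IH1: "DR (tw p q (contract b f)) as = tw p q (D (contract b f)) as" for b
    by (rule Cons.IH) (use pq f Cons.prems(4,5) in \<open>simp_all add: alt_contract\<close>)
  have IH2: "DR (tw q ?p' (contract b f)) as = tw q ?p' (D (contract b f)) as" for b
    by (rule Cons.IH) (use pq p' f Cons.prems(5) \<rho>p' in \<open>simp_all add: alt_contract\<close>)
  show ?case
    by (simp add: contract_twist contract_cartan_diff lin[OF descendent.linFF_D] LR IH1 IH2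
        grading_sign_algebra lin[OF linFF_twist[OF pq]] lin[OF linFF_twist[OF pq(2) p']]
        grading_sign_twist[OF pq] grading_sign_twist[OF pq(2) p'] del: V.scale_minus_left)
qed

end

section \<open>The total complex\<close>

lemma cartan_diff_alt_maps:
  assumes "lie_representation sA br sV \<rho>" and f: "f \<in> alt_maps sA sV n"
  shows "cartan_diff br \<rho> f \<in> alt_maps sA sV (n + 1)"
    and "CE_coboundary sV br \<rho> n f = cartan_diff br \<rho> f"
proof -
  interpret lie_representation sA br sV \<rho> by fact
  have a: "alt f" and v: "\<And>as. length as \<noteq> n \<Longrightarrow> f as = 0"
    using f by (simp_all add: alt_maps_iff)
  show "D f \<in> alt_maps sA sV (n + 1)"
    using alt_D[OF a] cartan_diff_homogeneous[of n f \<rho> _ br] v lin_zero[OF \<rho>_endo]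
    by (simp add: alt_maps_iff)
  show "CE_coboundary sV br \<rho> n f = D f" by (rule CE_coboundary_eq_D[OF f a])
qed

context coefficient_spaces
begin

lemma lie_deriv_alt_maps:
  "linAA t \<Longrightarrow> linVV r \<Longrightarrow> f \<in> alt_maps sA sV n \<Longrightarrow> lie_deriv t r f \<in> alt_maps sA sV n"
  by (simp add: alt_maps_iff alt_lie_deriv lie_deriv_local)

lemma twist_alt_maps:
  "linAA R \<Longrightarrow> linVV p \<Longrightarrow> linVV q \<Longrightarrow> f \<in> alt_maps sA sV n
    \<Longrightarrow> twist sV lam R p q f \<in> alt_maps sA sV n"
  by (simp add: alt_maps_iff alt_twist twist_local)

lemma alt_maps_algebra:
  "0 \<in> alt_maps sA sV n"
  "f \<in> alt_maps sA sV n \<Longrightarrow> g \<in> alt_maps sA sV n \<Longrightarrow> f + g \<in> alt_maps sA sV n"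
  "f \<in> alt_maps sA sV n \<Longrightarrow> g \<in> alt_maps sA sV n \<Longrightarrow> f - g \<in> alt_maps sA sV n"
  "f \<in> alt_maps sA sV n \<Longrightarrow> - f \<in> alt_maps sA sV n"
  "f \<in> alt_maps sA sV n \<Longrightarrow> fun_scale sV c f \<in> alt_maps sA sV n"
  by (simp_all add: alt_maps_iff alt_zero alt_add alt_diff alt_neg alt_scale)
    (simp_all add: fun_scale_def)

abbreviation "fscale \<equiv> (fun_scale sV :: 'k \<Rightarrow> ('a list \<Rightarrow> 'v) \<Rightarrow> _)"

sublocale F: vector_space fscale
  by (rule vector_space_fun_scale[OF V.vector_space_axioms])

sublocale F2: vector_space_prod fscale fscale
  by unfold_locales

lemma scale2_eq_prod: "scale2 sV = F2.scale"
  by (simp add: scale2_def)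

lemma scale2_Pair: "scale2 sV c (f, g) = (fscale c f, fscale c g)"
  by (simp add: scale2_eq_prod F2.scale_prod)

sublocale S2: vector_space "scale2 sV :: 'k \<Rightarrow> ('a, 'v) cochain2 \<Rightarrow> _"
  unfolding scale2_eq_prod by (rule F2.p.vector_space_axioms)

sublocale S4: vector_space_prod "scale2 sV :: 'k \<Rightarrow> ('a, 'v) cochain2 \<Rightarrow> _" "scale2 sV :: 'k \<Rightarrow> ('a, 'v) cochain2 \<Rightarrow> _"
  by unfold_locales

lemma scale4_eq_prod: "scale4 sV = S4.scale"
  by (simp add: scale4_def)

lemma scale4_Pair:
  fixes x y :: "('a, 'v) cochain2"
  shows "scale4 sV c (x, y) = (scale2 sV c x, scale2 sV c y)"
  by (simp add: scale4_eq_prod S4.scale_prod)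

lemma vector_space_scale4: "vector_space (scale4 sV :: 'k \<Rightarrow> ('a, 'v) cochain4 \<Rightarrow> _)"
  unfolding scale4_eq_prod by (rule S4.p.vector_space_axioms)

lemma subspace_mRBLA_cochains: "S2.subspace (mRBLA_cochains sA sV n)"
  unfolding S2.subspace_def mRBLA_cochains_def
  by (auto simp: alt_maps_algebra scale2_Pair zero_prod_def)

lemma subspace_mRBLD_cochains:
  "module.subspace (scale4 sV) (mRBLD_cochains sA sV n)"
proof -
  have "mRBLD_cochains sA sV 1 = (alt_maps sA sV 1 \<times> {0}) \<times> {0}"
    by (auto simp: mRBLD_cochains_def zero_prod_def)
  moreover have "S2.subspace (alt_maps sA sV 1 \<times> {0})"
    unfolding S2.subspace_def by (auto simp: alt_maps_algebra scale2_Pair zero_prod_def)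
  ultimately have "S4.p.subspace (mRBLD_cochains sA sV 1)"
    by (simp add: S4.subspace_Times)
  moreover have "S4.p.subspace (mRBLD_cochains sA sV n)" if "n \<noteq> 1"
    using that by (simp add: mRBLD_cochains_def S4.subspace_Times subspace_mRBLA_cochains)
  ultimately show ?thesis unfolding scale4_eq_prod by metis
qed

end

context mRB_LieDer_representation
begin

abbreviation "\<phi> \<equiv> tw id (\<lambda>u. - R\<^sub>V u)"
abbreviation "Ld \<equiv> lie_deriv d d\<^sub>V"

lemma linVV_id: "linVV id" and linVV_neg_RV: "linVV (\<lambda>u. - R\<^sub>V u)"
  using V.vector_space_axioms by (simp_all add: Vector_Spaces.linear_iff linearities)

lemma linFF_\<phi>: "linFF \<phi>"
  by (rule linFF_twist[OF linVV_id linVV_neg_RV])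

lemma linFF_Ld: "linFF Ld"
  by (rule linFF_lie_deriv[OF dV_linear])

lemma DR_\<phi>: assumes "alt f" shows "DR (\<phi> f) = \<phi> (D f)"
proof
  fix as
  show "DR (\<phi> f) as = \<phi> (D f) as"
    by (rule twist_chain_map[OF linVV_id linVV_neg_RV assms])
      (simp_all add: \<rho>_RV linearities)
qed

lemma Ld_D: "alt f \<Longrightarrow> Ld (D f) = D (Ld f)"
  by (rule lie_deriv_D[OF d_linear dV_linear d_derivation \<rho>_dV])

lemma d_R: "d (R a) = R (d a)"
  using fun_cong[OF R_d_commute, of a] by simp

lemma Ld_DR: "alt f \<Longrightarrow> Ld (DR f) = DR (Ld f)"
  by (rule descendent.lie_deriv_D[OF d_linear dV_linear])
    (simp_all add: linearities d_derivation \<rho>_dV d_R RV_dV[symmetric] algebra_simps)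

lemma linVV_zero: "linVV (\<lambda>_. 0)"
  using V.vector_space_axioms by (simp add: Vector_Spaces.linear_iff)

lemma Ld_\<phi>: assumes "alt f" shows "Ld (\<phi> f) = \<phi> (Ld f)"
proof
  fix as
  have "lie_deriv (\<lambda>_. 0) (\<lambda>_. 0) f = 0" by (rule ext) (simp add: lie_deriv_zero[OF assms])
  moreover have "linVV (\<lambda>u. sV (- lam) (id u))" by (rule linVV_scale[OF linVV_id])
  ultimately show "Ld (\<phi> f) as = \<phi> (Ld f) as"
    using lie_deriv_twist[OF linVV_id linVV_neg_RV dV_linear dV_linear linVV_zero assms,
        where lam = lam and R = R and t' = d and ta = d and tb = "\<lambda>_. 0"]
      lin_zero[OF linFF_twist[OF linVV_neg_RV, of "\<lambda>u. sV (- lam) (id u)" lam R]]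
    by (simp add: d_R linearities RV_dV)
qed

text \<open>
  The differential and the map \<open>\<Delta>\<close> of the inner mapping cone, and below the total differential, written
  with the recursive operators and hence independent of the degree apart from one sign.
\<close>

definition cone_diff :: "('a, 'v) cochain2 \<Rightarrow> ('a, 'v) cochain2" where
  "cone_diff = (\<lambda>(f, g). (D f, - DR g - \<phi> f))"

definition cone_Delta :: "('a, 'v) cochain2 \<Rightarrow> ('a, 'v) cochain2" where
  "cone_Delta = (\<lambda>(f, g). (- Ld f, - Ld g))"

lemma cone_diff_linear: "Vector_Spaces.linear (scale2 sV) (scale2 sV) cone_diff"
  unfolding Vector_Spaces.linear_iff
  by (auto simp: S2.vector_space_axioms cone_diff_def scale2_Pair lin[OF linFF_D] lin[OF linFF_\<phi>]
      lin[OF descendent.linFF_D] F.scale_right_diff_distrib)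

lemma cone_Delta_linear: "Vector_Spaces.linear (scale2 sV) (scale2 sV) cone_Delta"
  unfolding Vector_Spaces.linear_iff
  by (auto simp: S2.vector_space_axioms cone_Delta_def scale2_Pair lin[OF linFF_Ld])

lemma mRBLA_diff_eq_cone_diff:
  "x \<in> mRBLA_cochains sA sV n \<Longrightarrow> mRBLA_diff sV br lam R \<rho> R\<^sub>V n x = cone_diff x"
  using RV_linear cartan_diff_alt_maps(2)[OF lie_representation_axioms]
    cartan_diff_alt_maps(2)[OF descendent_representation]
  by (auto simp: mRBLA_cochains_def mRBLA_diff_def cone_diff_def mRBO_coboundary_def phi_eq_twist alt_maps_iff)

lemma mRBLA_Delta_eq_cone_Delta:
  "x \<in> mRBLA_cochains sA sV n \<Longrightarrow> mRBLA_Delta d d\<^sub>V n x = cone_Delta x"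
  using dV_linear
  by (auto simp: mRBLA_cochains_def mRBLA_Delta_def cone_Delta_def Delta_eq_lie_deriv)

lemma cone_diff_maps:
  assumes "n \<ge> 1" "x \<in> mRBLA_cochains sA sV n"
  shows "cone_diff x \<in> mRBLA_cochains sA sV (n + 1)"
proof -
  obtain f g where x: "x = (f, g)" by (cases x)
  have f: "f \<in> alt_maps sA sV n" and g: "g \<in> alt_maps sA sV (n - 1)"
    using assms(2) by (simp_all add: x mRBLA_cochains_def)
  have "DR g \<in> alt_maps sA sV n"
    using cartan_diff_alt_maps(1)[OF descendent_representation g] assms(1) by simp
  then show ?thesis
    using cartan_diff_alt_maps(1)[OF lie_representation_axioms f]
      twist_alt_maps[OF R_linear linVV_id linVV_neg_RV f]
    by (simp add: x cone_diff_def mRBLA_cochains_def alt_maps_algebra)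
qed

lemma cone_Delta_maps: "x \<in> mRBLA_cochains sA sV n \<Longrightarrow> cone_Delta x \<in> mRBLA_cochains sA sV n"
  using d_linear dV_linear
  by (auto simp: cone_Delta_def mRBLA_cochains_def alt_maps_algebra lie_deriv_alt_maps)

lemma cone_diff_cone_diff: "x \<in> mRBLA_cochains sA sV n \<Longrightarrow> cone_diff (cone_diff x) = 0"
  by (auto simp: cone_diff_def mRBLA_cochains_def alt_maps_iff D_D descendent.D_D DR_\<phi>
      lin[OF descendent.linFF_D] zero_prod_def)

lemma cone_Delta_cone_diff: "x \<in> mRBLA_cochains sA sV n \<Longrightarrow> cone_Delta (cone_diff x) = cone_diff (cone_Delta x)"
  by (auto simp: cone_diff_def cone_Delta_def mRBLA_cochains_def alt_maps_iff Ld_D Ld_DR Ld_\<phi>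
      lin[OF linFF_Ld] lin[OF linFF_D] lin[OF descendent.linFF_D] lin[OF linFF_\<phi>])

definition total_diff :: "nat \<Rightarrow> ('a, 'v) cochain4 \<Rightarrow> ('a, 'v) cochain4" where
  "total_diff n = (\<lambda>(x, y). (cone_diff x, cone_diff y + scale2 sV ((-1) ^ n) (cone_Delta x)))"

lemma total_diff_linear: "Vector_Spaces.linear (scale4 sV) (scale4 sV) (total_diff n)"
  unfolding Vector_Spaces.linear_iff
  by (auto simp: vector_space_scale4 total_diff_def scale4_Pair lin[OF cone_diff_linear] lin[OF cone_Delta_linear]
      S2.scale_right_distrib mult.commute)

lemma mRBLD_cochainsD:
  "(x, y) \<in> mRBLD_cochains sA sV n \<Longrightarrow>
    x \<in> mRBLA_cochains sA sV n \<and> y \<in> mRBLA_cochains sA sV (n - 1) \<and> (n = 1 \<longrightarrow> snd x = 0 \<and> y = 0)"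
  by (auto simp: mRBLD_cochains_def mRBLA_cochains_def alt_maps_algebra zero_prod_def split: if_splits)

text \<open>
  In degree one the second component \<open>y\<close> is zero, so that the special formula \<open>- \<Delta>\<close> is the general one with
  the sign \<open>(-1)\<^sup>1\<close>.
\<close>

lemma mRBLD_diff_eq_total_diff:
  assumes "z \<in> mRBLD_cochains sA sV n"
  shows "mRBLD_diff sV br lam R d \<rho> R\<^sub>V d\<^sub>V n z = total_diff n z"
proof -
  obtain f g h s where z: "z = ((f, g), (h, s))" by (metis prod.exhaust)
  note m = mRBLD_cochainsD[OF assms[unfolded z]]
  show ?thesis
  proof (cases "n = 1")
    case True
    then have "g = 0" "(h, s) = 0" using m by auto
    then show ?thesis
      using m True mRBLA_diff_eq_cone_diff[of "(f, g)" 1] mRBLA_Delta_eq_cone_Delta[of "(f, g)" 1]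
      by (simp add: z mRBLD_diff_def total_diff_def lin_zero[OF cone_diff_linear])
  next
    case False
    then show ?thesis
      using m mRBLA_diff_eq_cone_diff[of "(f, g)" n] mRBLA_Delta_eq_cone_Delta[of "(f, g)" n]
        mRBLA_diff_eq_cone_diff[of "(h, s)" "n - 1"]
      by (simp add: z mRBLD_diff_def total_diff_def)
  qed
qed

lemma total_diff_maps:
  assumes n: "n \<ge> 1" and z: "z \<in> mRBLD_cochains sA sV n"
  shows "total_diff n z \<in> mRBLD_cochains sA sV (n + 1)"
proof -
  obtain x y where xy: "z = (x, y)" by (cases z)
  note m = mRBLD_cochainsD[OF z[unfolded xy]]
  \<comment> \<open>Only \<open>y = 0\<close> occurs in degree one; on other elements the cone differential would leave the complex there.\<close>
  have "cone_diff y \<in> mRBLA_cochains sA sV n"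
  proof (cases "n = 1")
    case True
    then show ?thesis using m S2.subspace_0[OF subspace_mRBLA_cochains] by (simp add: lin_zero[OF cone_diff_linear])
  next
    case False
    then show ?thesis using m cone_diff_maps[of "n - 1" y] n by simp
  qed
  moreover have "scale2 sV c (cone_Delta x) \<in> mRBLA_cochains sA sV n" for c
    using m cone_Delta_maps S2.subspace_scale[OF subspace_mRBLA_cochains] by blast
  ultimately show ?thesis
    using m n cone_diff_maps[of n x] S2.subspace_add[OF subspace_mRBLA_cochains]
    by (simp add: xy total_diff_def mRBLD_cochains_def)
qed

lemma total_diff_total_diff:
  assumes "z \<in> mRBLD_cochains sA sV n"
  shows "total_diff (n + 1) (total_diff n z) = 0"
proof -
  obtain x y where xy: "z = (x, y)" by (cases z)
  note m = mRBLD_cochainsD[OF assms[unfolded xy]]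
  show ?thesis
    using m cone_diff_cone_diff[of x n] cone_diff_cone_diff[of y "n - 1"] cone_Delta_cone_diff[of x n]
    by (simp add: xy total_diff_def lin[OF cone_diff_linear] zero_prod_def)
qed

end

theorem theorem3p7:
  fixes sA :: "'k::field_char_0 \<Rightarrow> 'a::ab_group_add \<Rightarrow> 'a"
    and br :: "'a \<Rightarrow> 'a \<Rightarrow> 'a"
    and lam :: 'k
    and R d :: "'a \<Rightarrow> 'a"
    and sV :: "'k \<Rightarrow> 'v::ab_group_add \<Rightarrow> 'v"
    and \<rho> :: "'a \<Rightarrow> 'v \<Rightarrow> 'v"
    and R\<^sub>V d\<^sub>V :: "'v \<Rightarrow> 'v"
  assumes "mRB_LieDer_pair sA br lam R d"
    and "mRB_LieDer_representation sA br lam R d sV \<rho> R\<^sub>V d\<^sub>V"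
  shows "cochain_complex (scale4 sV) 1 (mRBLD_cochains sA sV)
           (mRBLD_diff sV br lam R d \<rho> R\<^sub>V d\<^sub>V)"
proof -
  interpret mRB_LieDer_representation sA br lam R d sV \<rho> R\<^sub>V d\<^sub>V by fact
  interpret S: vector_space "scale4 sV :: 'k \<Rightarrow> ('a, 'v) cochain4 \<Rightarrow> _"
    by (rule vector_space_scale4)
  note sub = subspace_mRBLD_cochains
  show ?thesis
  proof
    fix n :: nat and x y :: "('a, 'v) cochain4" and c :: 'k
    assume n: "1 \<le> n" and x: "x \<in> mRBLD_cochains sA sV n"
    note eq = mRBLD_diff_eq_total_diff[of _ n]
    show "mRBLD_diff sV br lam R d \<rho> R\<^sub>V d\<^sub>V n x \<in> mRBLD_cochains sA sV (n + 1)"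
      using total_diff_maps[OF n x] eq[OF x] by simp
    show "mRBLD_diff sV br lam R d \<rho> R\<^sub>V d\<^sub>V n (scale4 sV c x) =
        scale4 sV c (mRBLD_diff sV br lam R d \<rho> R\<^sub>V d\<^sub>V n x)"
      by (simp add: eq x S.subspace_scale[OF sub] lin[OF total_diff_linear])
    show "mRBLD_diff sV br lam R d \<rho> R\<^sub>V d\<^sub>V (n + 1)
        (mRBLD_diff sV br lam R d \<rho> R\<^sub>V d\<^sub>V n x) = 0"
      using total_diff_total_diff[OF x] total_diff_maps[OF n x] by (simp add: eq x mRBLD_diff_eq_total_diff[of _ "Suc n"])
    assume y: "y \<in> mRBLD_cochains sA sV n"
    show "mRBLD_diff sV br lam R d \<rho> R\<^sub>V d\<^sub>V n (x + y) =
        mRBLD_diff sV br lam R d \<rho> R\<^sub>V d\<^sub>V n x + mRBLD_diff sV br lam R d \<rho> R\<^sub>V d\<^sub>V n y"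
      by (simp add: eq x y S.subspace_add[OF sub] lin[OF total_diff_linear])
  qed (rule sub)
qed

end
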